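(* Let $\nu_0$ be a probability measure on $\mathbb{R}_+$ with compact support contained in $[0,A]$ for some $A>0$. For each $n\ge 1$ let $(r_j^{(n)})_{1\le j\le n}$ be an increasing sequence in $\mathbb{R}_+$ such that $$\frac{1}{n}\sum_{j=1}^n\delta_{r_j^{(n)}}\longrightarrow \nu_0 \quad\text{weakly as } n\to\infty .$$ Let $(m_n)_{n\ge 1}$ be a sequence of positive integers satisfying $$\frac{m_n}{\log n}\longrightarrow \infty\quad\text{as } n\to\infty .$$ Define the polynomial of degree $n m_n$ $$P_{n,m_n}(z)=\prod_{j=1}^n\bigl(z^{m_n}-(r_j^{(n)})^{m_n}\bigr)=\prod_{j=1}^n\prod_{k=0}^{m_n-1}\Bigl(z-r_j^{(n)}e^{2\pi i k/m_n}\Bigr).$$ Fix $t\in(0,1)$ and consider the $\lfloor n m_n t\rfloor$-th derivative $P_{n,m_n}^{(\lfloor n m_n t\rfloor)}$. Then, as $n\to\infty$, the empirical measure of its roots converges weakly to $$\mu_t=\nu_t\otimes \mathrm{unif},$$ where $\mathrm{unif}$ is the uniform probability measure on the unit circle and $\nu_t$ is the probability distribution of the random variable $$\Bigl(1-\frac{t}{V_t}\Bigr)q_{\nu_0}(V_t),$$ with $V_t$ uniformly distributed on $[t,1]$ and $q_{\nu_0}$ the quantile function of $\nu_0$, given by $q_{\nu_0}(\alpha)=\inf\{y\ge 0:\ \nu_0([0,y])\ge \alpha\}$. Moreover, the quantile function of the sub-probability measure $(1-t)\nu_t$ (which has total mass $1-t$) satisfies $$q_{(1-t)\nu_t}(x)=\frac{x}{x+t}\,q_{\nu_0}(x+t),\qquad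 0\le x\le 1-t .$$
   Context: $\mathbb{R}_+=[0,\infty)$, and $\delta_x$ is the Dirac mass at $x$. The empirical measure of the roots of a polynomial of degree $d\ge 1$ is the probability measure on $\mathbb{C}$ equal to $\frac1d$ times the sum of the Dirac masses at its roots, counted with multiplicity. For a probability measure $\nu$ on $\mathbb{R}_+$, the notation $\nu\otimes\mathrm{unif}$ denotes the rotationally invariant probability measure on $\mathbb{C}$ obtained in polar coordinates, i.e. the law of $R\,\Theta$ with $R\sim\nu$ and $\Theta$ uniform on the unit circle, $R$ and $\Theta$ independent. The quantile function of a finite measure $\nu$ on $\mathbb{R}_+$ of total mass $c\leq 1$ is $q_\nu(x)=\inf\{y\ge 0:\ \nu([0,y])\ge x\}$ for $0\le x\le c$. *)

theory Defs
  imports "HOL-Probability.Probability"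
    "HOL-Computational_Algebra.Fundamental_Theorem_Algebra"
begin

text \<open>
  Weak convergence of Borel measures on an arbitrary topological space; the library's
  \<^const>\<open>weak_conv_m\<close> only covers the real line, where the two notions agree.
\<close>

definition weakly_converges ::
  "(nat \<Rightarrow> 'a::topological_space measure) \<Rightarrow> 'a measure \<Rightarrow> bool" where
  "weakly_converges M_seq M \<longleftrightarrow>
    (\<forall>f :: 'a \<Rightarrow> real. continuous_on UNIV f \<and> bounded (range f) \<longrightarrow>
      (\<lambda>n. \<integral>x. f x \<partial>M_seq n) \<longlonglongrightarrow> (\<integral>x. f x \<partial>M))"

lemma weakly_converges_real_iff:
  assumes "\<And>n. real_distribution (M_seq n)" "real_distribution M"
  shows "weakly_converges M_seq M \<longleftrightarrow> weak_conv_m M_seq M"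
proof
  assume *: "weakly_converges M_seq M"
  show "weak_conv_m M_seq M"
  proof (rule integral_bdd_continuous_conv_imp_weak_conv)
    fix f :: "real \<Rightarrow> real"
    assume "\<And>x. isCont f x" "\<And>x. \<bar>f x\<bar> \<le> 1"
    then have "continuous_on UNIV f \<and> bounded (range f)"
      by (auto simp: continuous_on_eq_continuous_at bounded_iff)
    then show "(\<lambda>n. integral\<^sup>L (M_seq n) f) \<longlonglongrightarrow> integral\<^sup>L M f"
      using * by (auto simp: weakly_converges_def)
  qed (use assms in auto)
next
  assume *: "weak_conv_m M_seq M"
  show "weakly_converges M_seq M"
    unfolding weakly_converges_def
  proof safe
    fix f :: "real \<Rightarrow> real"
    assume c: "continuous_on UNIV f" and "bounded (range f)"
    then obtain B where "\<And>x. norm (f x) \<le> B" by (auto simp: bounded_iff)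
    then show "(\<lambda>n. \<integral>x. f x \<partial>M_seq n) \<longlonglongrightarrow> (\<integral>x. f x \<partial>M)"
      using c assms *
      by (intro weak_conv_imp_integral_bdd_continuous_conv)
        (auto simp: continuous_on_eq_continuous_at)
  qed
qed

text \<open>
  \<open>(1 / size X) * (\<Sum>x\<in>#X. \<delta>\<^sub>x)\<close> as a Borel measure, for a nonempty multiset \<open>X\<close>;
  the explicit formula is \<open>empirical_measure_eq\<close>.
\<close>

definition empirical_measure :: "'a::topological_space multiset \<Rightarrow> 'a measure" where
  "empirical_measure X = distr (measure_pmf (pmf_of_multiset X)) borel (\<lambda>x. x)"

definition root_measure :: "complex poly \<Rightarrow> complex measure" where
  "root_measure p = empirical_measure (proots p)"

lemma sum_mset_eq_sum_count:
  "(\<Sum>x\<in>#X. f x) = (\<Sum>x\<in>set_mset X. real (count X x) * f x)"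
proof (induction X)
  case (add a X)
  have "(\<Sum>x\<in>set_mset (add_mset a X). real (count (add_mset a X) x) * f x) =
      (\<Sum>x\<in>insert a (set_mset X). real (count X x) * f x + (if x = a then f x else 0))"
    by (intro sum.cong) (auto simp: algebra_simps)
  also have "\<dots> = (\<Sum>x\<in>insert a (set_mset X). real (count X x) * f x) + f a"
    by (simp add: sum.distrib sum.delta)
  also have "(\<Sum>x\<in>insert a (set_mset X). real (count X x) * f x) =
      (\<Sum>x\<in>set_mset X. real (count X x) * f x)"
    by (intro sum.mono_neutral_right) (auto simp: not_in_iff)
  finally show ?case using add by simp
qed simp

lemma empirical_measure_eq:
  assumes "X \<noteq> {#}" "B \<in> sets borel"
  shows "measure (empirical_measure X) B = (\<Sum>x\<in>#X. indicator B x :: real) / size X"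
proof -
  have "measure (empirical_measure X) B = measure (measure_pmf (pmf_of_multiset X)) B"
    using assms by (simp add: empirical_measure_def measure_distr)
  also have "\<dots> = measure (measure_pmf (pmf_of_multiset X)) (B \<inter> set_mset X)"
    using assms by (metis measure_Int_set_pmf set_pmf_of_multiset)
  also have "\<dots> = (\<Sum>x\<in>B \<inter> set_mset X. count X x / size X)"
    using assms by (simp add: measure_measure_pmf_finite)
  also have "\<dots> = (\<Sum>x\<in>set_mset X. real (count X x) * indicator B x / size X)"
    by (intro sum.mono_neutral_cong_left) (auto simp: indicator_def)
  also have "\<dots> = (\<Sum>x\<in>#X. indicator B x :: real) / size X"
    by (simp only: sum_mset_eq_sum_count sum_divide_distrib)
  finally show ?thesis .
qed

lemma root_measure_eq:
  assumes "degree p \<ge> 1" "B \<in> sets borel"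
  shows "measure (root_measure p) B =
    (\<Sum>z\<in>{z. poly p z = 0}. real (order z p) * indicator B z) / degree p"
proof -
  have p: "p \<noteq> 0" using assms by auto
  have ne: "proots p \<noteq> {#}"
    using assms size_proots_complex[of p] by auto
  show ?thesis
    unfolding root_measure_def using empirical_measure_eq[OF ne assms(2)] p
    by (simp add: sum_mset_eq_sum_count size_proots_complex mult.commute)
qed

text \<open>Meaningful for \<open>0 \<le> x \<le> c\<close>, where \<open>c\<close> is the total mass of \<open>\<nu>\<close>.\<close>

definition quantile :: "real measure \<Rightarrow> real \<Rightarrow> real" where
  "quantile \<nu> x = Inf {y. 0 \<le> y \<and> x \<le> measure \<nu> {0..y}}"

definition unif_circle :: "complex measure" where
  "unif_circle = distr (uniform_measure lborel {0..2 * pi}) borel cis"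

text \<open>The law of \<open>R * \<Theta>\<close>, for \<open>(R, \<Theta>)\<close> distributed according to the product measure.\<close>

definition radial_measure :: "real measure \<Rightarrow> complex measure" where
  "radial_measure \<nu> =
    distr (\<nu> \<Otimes>\<^sub>M unif_circle) borel (\<lambda>(r, \<theta>). complex_of_real r * \<theta>)"

definition poly_nm :: "nat \<Rightarrow> nat \<Rightarrow> (nat \<Rightarrow> real) \<Rightarrow> complex poly" where
  "poly_nm n m r = (\<Prod>j=1..n. monom 1 m - [:complex_of_real (r j ^ m):])"

text \<open>The law \<open>\<nu>\<^sub>t\<close> of \<open>(1 - t / V) * quantile \<nu>0 V\<close> with \<open>V\<close> uniform on \<open>[t, 1]\<close>.\<close>

definition nu_t :: "real measure \<Rightarrow> real \<Rightarrow> real measure" where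
  "nu_t \<nu>0 t =
    distr (uniform_measure lborel {t..1}) borel (\<lambda>v. (1 - t / v) * quantile \<nu>0 v)"

text \<open>The measures above are indeed probability measures, in particular the functions
  whose image measures are taken are measurable.\<close>

lemma measurable_quantile:
  assumes "real_distribution \<nu>" "measure \<nu> {0..A} = 1"
  shows "quantile \<nu> \<in> borel_measurable borel"
proof -
  interpret real_distribution \<nu> by fact
  have 1: "mono_on {..1} (quantile \<nu>)"
  proof (rule mono_onI)
    fix x y :: real assume xy: "x \<in> {..1}" "y \<in> {..1}" "x \<le> y"
    have "0 \<le> A" using assms(2) by (cases "0 \<le> A") auto
    then have "A \<in> {z. 0 \<le> z \<and> y \<le> measure \<nu> {0..z}}" using assms(2) xy by auto
    then show "quantile \<nu> x \<le> quantile \<nu> y"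
      unfolding quantile_def using xy
      by (intro cInf_superset_mono) (auto intro!: bdd_belowI[of _ 0])
  qed
  have 2: "quantile \<nu> x = Inf {}" if "x > 1" for x
  proof -
    have "{y. 0 \<le> y \<and> x \<le> measure \<nu> {0..y}} = {}"
      using that by (auto simp: not_le intro: order.strict_trans1[OF prob_le_1])
    then show ?thesis unfolding quantile_def by (rule arg_cong)
  qed
  have "quantile \<nu> \<in> borel_measurable (restrict_space borel {..1})"
    using 1 by (rule borel_measurable_mono_on_fnc)
  moreover have "(\<lambda>x. Inf {} :: real) \<in> borel_measurable (restrict_space borel {x. \<not> x \<in> {..1::real}})"
    by simp
  ultimately have "(\<lambda>x. if x \<in> {..1} then quantile \<nu> x else Inf {}) \<in> borel_measurable borel"
    by (subst measurable_If_restrict_space_iff) (auto simp: atMost_def)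
  moreover have "(\<lambda>x. if x \<in> {..1} then quantile \<nu> x else Inf {}) = quantile \<nu>"
    using 2 by auto
  ultimately show ?thesis by simp
qed

lemma prob_space_nu_t:
  assumes "real_distribution \<nu>0" "measure \<nu>0 {0..A} = 1" "0 < t" "t < 1"
  shows "prob_space (nu_t \<nu>0 t)"
proof -
  have [measurable]: "quantile \<nu>0 \<in> borel_measurable borel"
    using assms by (intro measurable_quantile)
  interpret prob_space "uniform_measure lborel {t..1}"
    using assms by (intro prob_space_uniform_measure) auto
  show ?thesis unfolding nu_t_def by (rule prob_space_distr) measurable
qed

lemma prob_space_unif_circle: "prob_space unif_circle"
proof -
  interpret prob_space "uniform_measure lborel {0..2 * pi}"
    by (intro prob_space_uniform_measure) auto
  have [measurable]: "cis \<in> borel_measurable borel"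
    by (intro borel_measurable_continuous_onI continuous_intros)
  show ?thesis unfolding unif_circle_def by (rule prob_space_distr) measurable
qed

lemma prob_space_radial_measure:
  assumes "prob_space \<nu>" and [measurable_cong]: "sets \<nu> = sets borel"
  shows "prob_space (radial_measure \<nu>)"
proof -
  interpret A: prob_space \<nu> by fact
  interpret B: prob_space unif_circle by (rule prob_space_unif_circle)
  interpret pair_prob_space \<nu> unif_circle ..
  have [measurable_cong]: "sets unif_circle = sets borel" by (simp add: unif_circle_def)
  show ?thesis unfolding radial_measure_def by (rule prob_space_distr) measurable
qed

lemma poly_nm_eq_prod_linear:
  assumes "m \<ge> 1"
  shows "poly_nm n m r =
    (\<Prod>j=1..n. \<Prod>k<m. [:- (complex_of_real (r j) * exp (2 * of_real pi * \<i> * of_nat k / of_nat m)), 1:])"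
proof -
  have *: "monom 1 m - [:c ^ m:] = (\<Prod>k<m. [:- (c * exp (2 * of_real pi * \<i> * of_nat k / of_nat m)), 1:])"
    for c :: complex
  proof -
    let ?w = "\<lambda>k. exp (2 * of_real pi * \<i> * of_nat k / of_nat m) :: complex"
    have w: "?w k = cis (2 * pi * real k / real m)" for k
      by (simp add: cis_conv_exp mult_ac)
    show ?thesis
    proof (cases "c = 0")
      case True
      have "(\<Prod>k<m. [:0, 1::complex:]) = [:0, 1:] ^ m" by simp
      then show ?thesis using assms True by (simp add: monom_altdef)
    next
      case False
      have wm: "?w k ^ m = 1" for k
      proof -
        have "?w k ^ m = exp (of_nat k * (2 * of_real pi * \<i>))"
          using assms by (subst exp_of_nat_mult[symmetric]) (auto simp: field_simps)
        then show ?thesis by (simp add: exp_of_nat_mult)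
      qed
      have inj: "inj_on ?w {..<m}"
        using bij_betw_roots_unity[of m] assms unfolding bij_betw_def w by simp
      have deg_l: "degree (monom 1 m - [:c ^ m:]) = m" and lc_l: "coeff (monom 1 m - [:c ^ m:]) m = 1"
      proof -
        show "coeff (monom 1 m - [:c ^ m:]) m = 1" using assms by (auto simp: coeff_pCons split: nat.splits)
        then show "degree (monom 1 m - [:c ^ m:]) = m"
          by (intro antisym degree_diff_le) (auto simp: degree_monom_le intro: le_degree)
      qed
      let ?R = "\<Prod>k<m. [:- (c * ?w k), 1:]"
      have deg_r: "degree ?R = m" by (subst degree_prod_eq_sum_degree) auto
      have lc_r: "coeff ?R m = 1"
        using lead_coeff_prod[of "\<lambda>k. [:- (c * ?w k), 1:]" "{..<m}"] deg_r by simp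
      show ?thesis
      proof (rule poly_eqI_degree_lead_coeff[where n = m and A = "(\<lambda>k. c * ?w k) ` {..<m}"])
        show "m \<le> card ((\<lambda>k. c * ?w k) ` {..<m})"
          using inj False by (subst card_image) (auto simp: inj_on_def)
        show "poly (monom 1 m - [:c ^ m:]) z = poly ?R z" if z: "z \<in> (\<lambda>k. c * ?w k) ` {..<m}" for z
        proof -
          obtain k where k: "k < m" "z = c * ?w k" using z by blast
          have "poly ?R z = 0" using k by (auto simp: poly_prod)
          moreover have "poly (monom 1 m - [:c ^ m:]) z = 0"
            unfolding k by (simp only: poly_diff poly_monom power_mult_distrib wm) simp
          ultimately show ?thesis by simp
        qed
      qed (use lc_l lc_r deg_l deg_r in simp_all)
    qed
  qed
  show ?thesis unfolding poly_nm_def using *[of "complex_of_real (r _)"] by simp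
qed

end

theory Submission
  imports Defs
begin

text \<open>
  Write \<open>P = Q(z\<^sup>m)\<close>. Differentiation preserves the shape \<open>z\<^sup>s S(z\<^sup>m)\<close>, where \<open>S\<close> has only roots
  in \<open>[0, \<infinity>)\<close>, so the \<open>l\<close>-th derivative is, up to a constant, \<open>z\<^sup>s (\<Prod>j=1..N. z\<^sup>m - (x j)\<^sup>m)\<close>
  with \<open>0 \<le> x 1 \<le> \<dots> \<le> x N\<close> and \<open>s < m\<close>. The \<open>k\<close>-th coefficient of a product of factors
  \<open>w - a j\<close> with increasing \<open>a j \<ge> 0\<close> is, up to sign and a factor in \<open>[1, 2\<^sup>n]\<close>, the product of the
  \<open>n - k\<close> largest \<open>a j\<close>. Comparing coefficients of \<open>P\<close> and its derivative, taking quotients over a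
  window of \<open>e\<close> indices and extracting an \<open>(m e)\<close>-th root turns the factors \<open>2\<^sup>n\<close> into \<open>1 + o(1)\<close>
  and the falling factorials into \<open>1 - l / (m k)\<close>; hence \<open>x (k - (n - N)) \<approx> (1 - l / (m k)) * r k\<close>.
  Thus the quantile function of the \<open>x j\<close> converges pointwise almost everywhere, and the averages
  of a test function over all roots converge by dominated convergence.
\<close>

section \<open>Real-rootedness of the derivatives\<close>

text \<open>One coefficient fixes only a product of many roots, and only up to \<open>2 ^ n\<close>,
  so it locates no single root. A quotient of two coefficients at distance \<open>e\<close> isolates
  \<open>e\<close> consecutive roots, which sortedness squeezes between the first and the last of
  them. Two demands on \<open>e\<close> then compete: it must be short, \<open>e / n\<close> tending
  to 0, so that both ends of the window see the same quantile, and long, \<open>n / (m e)\<close>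
  tending to 0, because the combined loss of at most \<open>4 ^ n\<close> survives the root
  extraction as \<open>4 powr (n / (m e))\<close>. As \<open>m\<close> tends to infinity there is
  room between the two scales. Limits of individual roots are obtained where the quantile function
  of \<open>\<nu>0\<close> is continuous; being monotone, it has only countably many other points.
  This is why radii are treated as functions of a relative rank in \<open>(0, 1]\<close>, with
  convergence almost everywhere.\<close>

lemma poly_pderiv_prod_linear:
  fixes z :: "'i \<Rightarrow> 'a::field"
  assumes "finite I" "\<And>i. i \<in> I \<Longrightarrow> w \<noteq> z i"
  shows "poly (pderiv (\<Prod>i\<in>I. [:- z i, 1:])) w =
    poly (\<Prod>i\<in>I. [:- z i, 1:]) w * (\<Sum>i\<in>I. 1 / (w - z i))"
  using assms
proof (induction I rule: finite_induct)
  case (insert a I)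
  define P where "P = (\<Prod>i\<in>I. [:- z i, 1:])"
  have "w - z a \<noteq> 0" using insert.prems by auto
  moreover have "poly (pderiv P) w = poly P w * (\<Sum>i\<in>I. 1 / (w - z i))"
    using insert unfolding P_def by auto
  moreover have "poly (pderiv ([:- z a, 1:] * P)) w = (w - z a) * poly (pderiv P) w + poly P w"
    by (simp only: pderiv_mult poly_add poly_mult) (simp add: pderiv_pCons algebra_simps)
  moreover have "poly ([:- z a, 1:] * P) w = (w - z a) * poly P w"
    by (simp only: poly_mult) simp
  moreover have "(\<Sum>i\<in>insert a I. 1 / (w - z i)) = 1 / (w - z a) + (\<Sum>i\<in>I. 1 / (w - z i))"
    using insert.hyps by simp
  ultimately have "poly (pderiv ([:- z a, 1:] * P)) w =
      poly ([:- z a, 1:] * P) w * (\<Sum>i\<in>insert a I. 1 / (w - z i))"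
    by (simp only: distrib_left) simp
  moreover have "(\<Prod>i\<in>insert a I. [:- z i, 1:]) = [:- z a, 1:] * P"
    using insert.hyps unfolding P_def by (rule prod.insert)
  ultimately show ?case by (simp only:)
qed simp

text \<open>
  Off \<open>[0, \<infinity>)\<close> the logarithmic derivative \<open>c + m (\<Sum>i. w / (w - x\<^sub>i))\<close> cannot vanish:
  its imaginary part is \<open>- m (Im w) (\<Sum>i. x\<^sub>i / |w - x\<^sub>i|\<^sup>2)\<close>, and for \<open>w < 0\<close> every summand
  is positive.
\<close>

lemma nonneg_roots_euler_operator:
  fixes S :: "complex poly" and c :: real and m :: nat
  assumes "S \<noteq> 0" and roots: "\<And>w. poly S w = 0 \<Longrightarrow> w \<in> \<real>\<^sub>\<ge>\<^sub>0"
    and "c \<ge> 0" "m > 0" and pos: "c > 0 \<or> degree S > 0"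
    and zero: "poly (smult (of_real c) S + smult (of_nat m) ([:0, 1:] * pderiv S)) w = 0"
  shows "w \<in> \<real>\<^sub>\<ge>\<^sub>0"
proof (rule ccontr)
  assume w: "w \<notin> \<real>\<^sub>\<ge>\<^sub>0"
  define N where "N = degree S"
  obtain z where z: "smult (lead_coeff S) (\<Prod>i<N. [:- z i, 1:]) = S"
    unfolding N_def by (rule complex_poly_decompose')
  have zi: "z i \<in> \<real>\<^sub>\<ge>\<^sub>0" if "i < N" for i
  proof (rule roots)
    show "poly S (z i) = 0" using that by (subst z[symmetric]) (auto simp: poly_prod)
  qed
  have zx: "z i = of_real (Re (z i))" "Re (z i) \<ge> 0" if "i < N" for i
    using zi[OF that] by (auto simp: complex_nonneg_Reals_iff complex_eq_iff)
  define x where "x = (\<lambda>i. Re (z i))"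
  have ne: "w - of_real (x i) \<noteq> 0" if "i < N" for i
    using zx(1)[OF that] zi[OF that] w unfolding x_def by force
  have S: "S = smult (lead_coeff S) (\<Prod>i<N. [:- of_real (x i), 1:])"
  proof -
    have "(\<Prod>i<N. [:- of_real (x i), 1:]) = (\<Prod>i<N. [:- z i, 1:])"
      using zx unfolding x_def by (intro prod.cong) (auto simp flip: zx(1))
    then show ?thesis using z by simp
  qed
  have Sw: "poly S w \<noteq> 0" using roots w by blast
  define L where "L = (\<Sum>i<N. 1 / (w - of_real (x i)))"
  have dS: "poly (pderiv S) w = poly S w * L"
  proof -
    have "poly (pderiv S) w = lead_coeff S * poly (pderiv (\<Prod>i<N. [:- of_real (x i), 1:])) w"
      by (subst S) (simp add: pderiv_smult)
    also have "\<dots> = lead_coeff S * poly (\<Prod>i<N. [:- of_real (x i), 1:]) w * L"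
      unfolding L_def using ne by (subst poly_pderiv_prod_linear) auto
    also have "lead_coeff S * poly (\<Prod>i<N. [:- of_real (x i), 1:]) w = poly S w"
      by (subst (3) S) simp
    finally show ?thesis .
  qed
  have "poly S w * (of_real c + of_nat m * (w * L)) = 0"
    using zero by (simp add: dS algebra_simps)
  with Sw have eq: "of_real c + of_nat m * (w * L) = 0" by simp
  have wL: "w * L = (\<Sum>i<N. w / (w - of_real (x i)))"
    by (simp add: L_def sum_distrib_left)
  show False
  proof (cases "Im w = 0")
    case True
    then have "Re w < 0" using w by (auto simp: complex_nonneg_Reals_iff)
    have wr: "w = of_real (Re w)" using True by (simp add: complex_eq_iff)
    have "w / (w - of_real (x i)) = of_real (Re w / (Re w - x i))" for i
      by (subst (1 2) wr) simp
    then have "Re (w * L) = (\<Sum>i<N. Re w / (Re w - x i))"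
      unfolding wL by simp
    moreover have "Re w / (Re w - x i) > 0" if "i < N" for i
      using \<open>Re w < 0\<close> zx(2)[OF that] by (intro divide_neg_neg) (auto simp: x_def)
    ultimately have "N > 0 \<longrightarrow> Re (w * L) > 0" "N = 0 \<longrightarrow> Re (w * L) = 0"
      using sum_pos[of "{..<N}" "\<lambda>i. Re w / (Re w - x i)"] by auto
    then have "Re (w * L) \<ge> 0" "N > 0 \<longrightarrow> Re (w * L) > 0"
      by (cases "N = 0"; simp del: times_complex.sel)+
    moreover have "c + real m * Re (w * L) = 0" using arg_cong[OF eq, of Re] by simp
    ultimately show False using \<open>m > 0\<close> \<open>c \<ge> 0\<close> pos
      by (metis N_def add_nonneg_pos add_pos_nonneg mult_nonneg_nonneg mult_pos_pos
        of_nat_0_le_iff of_nat_0_less_iff order_less_irrefl)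
  next
    case False
    have "Im (w / (w - of_real (x i))) = - Im w * (x i / (cmod (w - of_real (x i)))\<^sup>2)" for i
      by (simp add: Im_divide' algebra_simps)
    then have "Im (w * L) = - Im w * (\<Sum>i<N. x i / (cmod (w - of_real (x i)))\<^sup>2)"
      unfolding wL by (simp add: sum_distrib_left)
    moreover have "real m * Im (w * L) = 0" using arg_cong[OF eq, of Im] by simp
    ultimately have "(\<Sum>i<N. x i / (cmod (w - of_real (x i)))\<^sup>2) = 0"
      using \<open>m > 0\<close> False by simp
    then have "\<forall>i\<in>{..<N}. x i / (cmod (w - of_real (x i)))\<^sup>2 = 0"
      using zx(2) by (subst (asm) sum_nonneg_eq_0_iff) (auto simp: x_def)
    \<comment> \<open>The imaginary part says nothing when all \<open>x i\<close> vanish. In that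
      case \<open>w * L = N\<close>, and the equation reads \<open>c + m N = 0\<close>, which
      \<open>pos\<close> rules out.\<close>
    then have x0: "x i = 0" if "i < N" for i using that ne by auto
    have "w \<noteq> 0" using False by auto
    then have "w * L = of_nat N" unfolding wL using x0 by simp
    then have "of_real (c + real m * real N) = (0 :: complex)" using eq by simp
    then have "c + real m * real N = 0" unfolding of_real_eq_0_iff .
    then show False using pos \<open>c \<ge> 0\<close> \<open>m > 0\<close> unfolding N_def
      by (smt (verit) mult_pos_pos mult_nonneg_nonneg of_nat_0_le_iff of_nat_0_less_iff)
  qed
qed

text \<open>The Euler operator \<open>w d/dw\<close> is diagonal on monomials, so \<open>S\<close>
  keeps its degree as long as the eigenvalue at the top index is nonzero.\<close>

lemma coeff_euler_operator:
  "coeff (smult a S + smult b ([:0, 1:] * pderiv S)) k = (a + b * of_nat k) * coeff S k"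
  for a b :: "'a::idom"
  by (cases k) (auto simp: coeff_pderiv algebra_simps)

text \<open>With \<open>w = z ^ m\<close> the derivative is \<open>z ^ (s - 1)\<close> times
  \<open>s S + m w S'\<close>. For \<open>s = 0\<close> the exponent would be -1; the remaining term
  \<open>m w S'\<close> then lends its factor \<open>w\<close>, leaving \<open>z ^ (m - 1)\<close>
  and a polynomial of smaller degree.\<close>

lemma pderiv_monom_times_pcompose_monom:
  fixes S :: "'a::idom poly"
  assumes "m > 0"
  shows "pderiv (monom 1 s * pcompose S (monom 1 m)) =
    (if s = 0 then monom 1 (m - 1) * pcompose (smult (of_nat m) (pderiv S)) (monom 1 m)
     else monom 1 (s - 1) *
       pcompose (smult (of_nat s) S + smult (of_nat m) ([:0, 1:] * pderiv S)) (monom 1 m))"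
proof -
  show ?thesis
  proof (cases "s = 0")
    case True
    have "monom (of_nat m :: 'a) (m - 1) = smult (of_nat m) (monom 1 (m - 1))"
      by (simp add: smult_monom)
    with True show ?thesis
      by (simp add: pderiv_pcompose pderiv_monom pcompose_smult monom_0 mult.commute)
  next
    case False
    have 1: "monom 1 s * monom (of_nat m) (m - 1) = monom 1 (s - 1) * monom (of_nat m :: 'a) m"
      using assms False by (simp add: mult_monom)
    have "pderiv (monom 1 s * pcompose S (monom 1 m)) =
       (monom 1 s * monom (of_nat m) (m - 1)) * pcompose (pderiv S) (monom 1 m) +
       monom (of_nat s) (s - 1) * pcompose S (monom 1 m)"
      by (simp add: pderiv_mult pderiv_pcompose pderiv_monom mult_ac)
    also have "monom (of_nat s :: 'a) (s - 1) = monom 1 (s - 1) * monom (of_nat s) 0"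
      by (simp add: mult_monom)
    also have "monom 1 s * monom (of_nat m) (m - 1) =
        monom 1 (s - 1) * (monom (of_nat m :: 'a) 0 * monom 1 m)"
      unfolding 1 by (simp add: mult_monom)
    finally have "pderiv (monom 1 s * pcompose S (monom 1 m)) =
      monom 1 (s - 1) * (monom (of_nat s) 0 * pcompose S (monom 1 m)
        + monom (of_nat m) 0 * (monom 1 m * pcompose (pderiv S) (monom 1 m)))"
      by (simp only: algebra_simps)
    moreover have "pcompose [:0, 1:] (monom 1 m) = monom (1 :: 'a) m" by (simp add: pcompose_pCons)
    moreover have "monom a 0 * p = smult a p" for a and p :: "'a poly"
      by (simp add: monom_0)
    ultimately show ?thesis using False
      by (simp only: pcompose_add pcompose_smult pcompose_mult if_False)
  qed
qed

text \<open>Each derivative lowers \<open>s\<close> by one; from 0 it wraps around to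
  \<open>m - 1\<close> while \<open>degree S\<close> drops by one. So
  \<open>s + m * degree S\<close> is a counter that falls by exactly one per step, and the bound on
  \<open>l\<close> keeps it from running out.\<close>

lemma higher_pderiv_pcompose_monom:
  fixes Q :: "complex poly"
  assumes "m > 0" "Q \<noteq> 0" "\<And>w. poly Q w = 0 \<Longrightarrow> w \<in> \<real>\<^sub>\<ge>\<^sub>0" "l \<le> m * degree Q"
  shows "\<exists>s S. s < m \<and> S \<noteq> 0 \<and> (\<forall>w. poly S w = 0 \<longrightarrow> w \<in> \<real>\<^sub>\<ge>\<^sub>0) \<and>
    s + m * degree S + l = m * degree Q \<and>
    (pderiv ^^ l) (pcompose Q (monom 1 m)) = monom 1 s * pcompose S (monom 1 m)"
  using assms(4)
proof (induction l)
  case 0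
  show ?case using assms by (intro exI[of _ 0] exI[of _ Q]) (auto simp: monom_0)
next
  case (Suc l)
  then obtain s S where IH: "s < m" "S \<noteq> 0" "\<And>w. poly S w = 0 \<Longrightarrow> w \<in> \<real>\<^sub>\<ge>\<^sub>0"
    "s + m * degree S + l = m * degree Q"
    "(pderiv ^^ l) (pcompose Q (monom 1 m)) = monom 1 s * pcompose S (monom 1 m)" by auto
  show ?case
  proof (cases "s = 0")
    case True
    have deg: "degree S > 0" using IH(4) Suc.prems True by (cases "degree S") auto
    let ?S = "smult (of_nat m) (pderiv S)"
    have "pderiv S \<noteq> 0" using deg by (metis pderiv_eq_0_iff not_gr_zero)
    \<comment> \<open>With \<open>c = 0\<close> the operator is \<open>m w S'\<close>, so every zero
      of \<open>S'\<close> is a zero of it.\<close>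
    moreover have "w \<in> \<real>\<^sub>\<ge>\<^sub>0" if "poly ?S w = 0" for w
      using nonneg_roots_euler_operator[OF IH(2,3), of 0 m w] deg that \<open>m > 0\<close> by simp
    moreover have "degree ?S = degree S - 1" using \<open>m > 0\<close> by (simp add: degree_pderiv)
    moreover have "m - 1 + m * (degree S - 1) + Suc l = m * degree Q"
      using IH(4) deg True \<open>m > 0\<close> by (cases "degree S") auto
    moreover have "(pderiv ^^ Suc l) (pcompose Q (monom 1 m)) = monom 1 (m - 1) * pcompose ?S (monom 1 m)"
      using pderiv_monom_times_pcompose_monom[OF \<open>m > 0\<close>, of 0 S] True IH(5) by simp
    ultimately show ?thesis using \<open>m > 0\<close>
      by (intro exI[of _ "m - 1"] exI[of _ ?S] conjI) auto
  next
    case False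
    let ?S = "smult (of_nat s) S + smult (of_nat m) ([:0, 1:] * pderiv S)"
    have c: "coeff ?S k = of_nat (s + m * k) * coeff S k" for k
      unfolding coeff_euler_operator by simp
    have "s + m * k \<noteq> 0" for k using False by simp
    then have c0: "coeff ?S k = 0 \<longleftrightarrow> coeff S k = 0" for k unfolding c by (metis mult_eq_0_iff of_nat_eq_0_iff)
    then have "?S \<noteq> 0" using IH(2) by (metis poly_eq_iff coeff_0)
    moreover have "degree ?S = degree S" unfolding degree_def c0 ..
    moreover have "w \<in> \<real>\<^sub>\<ge>\<^sub>0" if "poly ?S w = 0" for w
      using nonneg_roots_euler_operator[OF IH(2,3), of "real s" m w] False that \<open>m > 0\<close> by simp
    moreover have "(pderiv ^^ Suc l) (pcompose Q (monom 1 m)) = monom 1 (s - 1) * pcompose ?S (monom 1 m)"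
      using pderiv_monom_times_pcompose_monom[OF \<open>m > 0\<close>, of s S] False IH(5) by simp
    moreover have "s - 1 + m * degree S + Suc l = m * degree Q" "s - 1 < m"
      using IH(1,4) False by auto
    ultimately show ?thesis by (intro exI[of _ "s - 1"] exI[of _ ?S]) presburger
  qed
qed

section \<open>Factorization of the derivative over sorted radii\<close>

lemma complex_poly_sorted_nonneg_roots:
  fixes S :: "complex poly"
  assumes "\<And>w. poly S w = 0 \<Longrightarrow> w \<in> \<real>\<^sub>\<ge>\<^sub>0"
  obtains y :: "nat \<Rightarrow> real" where "mono_on {1..degree S} y" "\<And>j. j \<in> {1..degree S} \<Longrightarrow> y j \<ge> 0"
    "S = smult (lead_coeff S) (\<Prod>j=1..degree S. [:- of_real (y j), 1:])"
proof (cases "S = 0")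
  case True
  then show ?thesis by (intro that[of "\<lambda>_. 0"]) (auto intro: mono_onI)
next
  case False
  define xs where "xs = sorted_list_of_multiset (image_mset Re (proots S))"
  have ms: "mset xs = image_mset Re (proots S)" by (simp add: xs_def)
  have len: "length xs = degree S"
    by (metis ms size_mset size_image_mset size_proots_complex)
  define y where "y = (\<lambda>j. xs ! (j - 1))"
  show ?thesis
  proof (rule that[of y])
    show "mono_on {1..degree S} y"
      unfolding y_def by (intro mono_onI sorted_nth_mono) (auto simp: xs_def len[symmetric])
    show "y j \<ge> 0" if "j \<in> {1..degree S}" for j
    proof -
      have "y j \<in># mset xs" using that len by (auto simp: y_def intro!: nth_mem)
      then show ?thesis using assms False unfolding ms by (auto simp: complex_nonneg_Reals_iff)
    qed
    have "(\<Prod>x\<in>#proots S. [:-x, 1:]) = (\<Prod>x\<in>#mset xs. [:- of_real x, 1:])"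
      unfolding ms image_mset.compositionality using assms False
      by (intro arg_cong[where f = prod_mset] image_mset_cong)
        (auto simp: complex_nonneg_Reals_iff complex_eq_iff)
    also have "\<dots> = (\<Prod>i<degree S. [:- of_real (xs ! i), 1:])"
      unfolding mset_map[symmetric] prod_mset_prod_list
      by (subst prod.list_conv_set_nth) (auto simp: atLeast0LessThan len)
    also have "\<dots> = (\<Prod>j=1..degree S. [:- of_real (y j), 1:])"
      unfolding y_def by (intro prod.reindex_bij_witness[of _ "\<lambda>j. j - 1" Suc]) auto
    finally show "S = smult (lead_coeff S) (\<Prod>j=1..degree S. [:- of_real (y j), 1:])"
      using complex_poly_decompose_multiset[of S] by simp
  qed
qed

lemma poly_nm_eq_pcompose:
  "poly_nm n m r = pcompose (\<Prod>j=1..n. [:- of_real (r j ^ m), 1:]) (monom 1 m)"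
proof -
  have "monom 1 m - [:a:] = pcompose [:- a, 1:] (monom 1 m)" for a :: complex
    by (simp add: pcompose_pCons)
  then show ?thesis unfolding poly_nm_def pcompose_prod by simp
qed

lemma higher_pderiv_poly_nm:
  assumes "m > 0" "\<And>j. j \<in> {1..n} \<Longrightarrow> r j \<ge> 0" "l \<le> n * m"
  obtains C s N x where "C \<noteq> 0" "s < m" "s + m * N + l = m * n"
    "\<And>j. j \<in> {1..N} \<Longrightarrow> x j \<ge> 0" "mono_on {1..N} x"
    "(pderiv ^^ l) (poly_nm n m r) = smult C (monom 1 s * poly_nm N m x)"
proof -
  define Q where "Q = (\<Prod>j=1..n. [:- of_real (r j ^ m), 1 :: complex:])"
  have Q: "Q \<noteq> 0" "degree Q = n"
    unfolding Q_def by (auto simp: degree_prod_eq_sum_degree)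
  have "w \<in> \<real>\<^sub>\<ge>\<^sub>0" if "poly Q w = 0" for w
    using that assms(2) by (auto simp: Q_def poly_prod)
  then obtain s S where S: "s < m" "S \<noteq> 0" "\<And>w. poly S w = 0 \<Longrightarrow> w \<in> \<real>\<^sub>\<ge>\<^sub>0"
    "s + m * degree S + l = m * n"
    "(pderiv ^^ l) (pcompose Q (monom 1 m)) = monom 1 s * pcompose S (monom 1 m)"
    using higher_pderiv_pcompose_monom[OF assms(1) Q(1), of l] assms(3) Q(2) by (auto simp: mult.commute)
  obtain y where y: "mono_on {1..degree S} y" "\<And>j. j \<in> {1..degree S} \<Longrightarrow> y j \<ge> 0"
    "S = smult (lead_coeff S) (\<Prod>j=1..degree S. [:- of_real (y j), 1:])"
    using complex_poly_sorted_nonneg_roots[OF S(3)] by blast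
  \<comment> \<open>The roots \<open>y j\<close> live in the variable \<open>w = z ^ m\<close>; the
    \<open>m\<close>-th root returns to radii in \<open>z\<close> and, being monotone, keeps them
    sorted.\<close>
  define x where "x = (\<lambda>j. root m (y j))"
  have xy: "x j ^ m = y j" if "j \<in> {1..degree S}" for j
    using y(2)[OF that] assms(1) by (simp add: x_def)
  have "pcompose S (monom 1 m) = smult (lead_coeff S) (poly_nm (degree S) m x)"
    unfolding poly_nm_eq_pcompose
    by (subst y(3)) (simp only: pcompose_smult, simp add: xy del: of_real_power)
  then have "(pderiv ^^ l) (poly_nm n m r) = smult (lead_coeff S) (monom 1 s * poly_nm (degree S) m x)"
    using S(5) unfolding poly_nm_eq_pcompose[of n] Q_def by simp
  moreover have "mono_on {1..degree S} x"
    using y(1) assms(1) unfolding x_def mono_on_def by (auto intro!: real_root_le_mono)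
  moreover have "x j \<ge> 0" if "j \<in> {1..degree S}" for j using y(2)[OF that] by (simp add: x_def real_root_ge_zero)
  ultimately show ?thesis using S(1,2,4) by (intro that[of "lead_coeff S" s "degree S" x]) auto
qed

section \<open>Root bounds from coefficients\<close>

lemma coeff_linear_times:
  "coeff ([:a, 1:] * p) k = a * coeff p k + (if k = 0 then 0 else coeff p (k - 1))"
  for a :: "'a::comm_ring_1"
  by (cases k) auto

text \<open>
  The \<open>k\<close>-th coefficient is an elementary symmetric polynomial: at most \<open>2 ^ n\<close> terms, the largest
  of which is the product of the \<open>n - k\<close> largest \<open>a j\<close>.
\<close>

lemma coeff_prod_linear_bounds:
  fixes a :: "nat \<Rightarrow> real"
  assumes "\<And>j. j \<in> {1..n} \<Longrightarrow> a j \<ge> 0" "mono_on {1..n} a" "k \<le> n"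
  shows "(\<Prod>j=k+1..n. a j) \<le> coeff (\<Prod>j=1..n. [:a j, 1:]) k"
    and "coeff (\<Prod>j=1..n. [:a j, 1:]) k \<le> 2 ^ n * (\<Prod>j=k+1..n. a j)"
proof -
  have "(\<Prod>j=k+1..n. a j) \<le> coeff (\<Prod>j=1..n. [:a j, 1:]) k \<and>
      coeff (\<Prod>j=1..n. [:a j, 1:]) k \<le> 2 ^ n * (\<Prod>j=k+1..n. a j)"
    using assms
  proof (induction n arbitrary: k)
    case 0
    then show ?case by simp
  next
    case (Suc n)
    define E where "E = (\<lambda>k. coeff (\<Prod>j=1..n. [:a j, 1:]) k)"
    define T where "T = (\<lambda>k. \<Prod>j=k+1..n. a j)"
    have a: "a (Suc n) \<ge> 0" using Suc.prems by auto
    have IH: "T k \<le> E k" "E k \<le> 2 ^ n * T k" if "k \<le> n" for k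
      using Suc.IH[of k] that Suc.prems unfolding E_def T_def by (auto simp: mono_on_def)
    have T0: "T k \<ge> 0" for k unfolding T_def using Suc.prems(1) by (auto intro!: prod_nonneg)
    have coeff: "coeff (\<Prod>j=1..Suc n. [:a j, 1:]) k =
        a (Suc n) * E k + (if k = 0 then 0 else E (k - 1))"
    proof -
      have "(\<Prod>j=1..Suc n. [:a j, 1:]) = [:a (Suc n), 1:] * (\<Prod>j=1..n. [:a j, 1:])"
        by (rule prod.nat_ivl_Suc') simp
      then show ?thesis unfolding E_def by (simp only: coeff_linear_times)
    qed
    show ?case
    proof (cases "k = Suc n")
      case True
      have "degree (\<Prod>j=1..n. [:a j, 1:]) = n"
        by (subst degree_prod_eq_sum_degree) auto
      moreover have "lead_coeff (\<Prod>j=1..n. [:a j, 1:]) = 1"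
        by (subst lead_coeff_prod) auto
      ultimately have "E n = 1" "E (Suc n) = 0"
        unfolding E_def by (auto intro: coeff_eq_0)
      then show ?thesis unfolding coeff using True
        by (simp add: one_le_power del: power_Suc)
    next
      case False
      then have k: "k \<le> n" using Suc.prems by auto
      have Tk: "(\<Prod>j=k+1..Suc n. a j) = a (Suc n) * T k"
        unfolding T_def using k by (simp add: prod.nat_ivl_Suc')
      have E0: "0 \<le> (if k = 0 then 0 else E (k - 1))"
        using IH(1)[of "k - 1"] T0[of "k - 1"] k by (auto intro: order_trans)
      \<comment> \<open>The recursion has two summands, and each is at most \<open>2 ^ n\<close>
        times the new tail. For this one, sortedness allows \<open>a k\<close> in
        \<open>T (k - 1) = a k * T k\<close> to be replaced by the larger
        \<open>a (Suc n)\<close>.\<close>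
      have "(if k = 0 then 0 else E (k - 1)) \<le> 2 ^ n * (a (Suc n) * T k)"
      proof (cases "k = 0")
        case False
        have "T (k - 1) = a k * T k"
          unfolding T_def using k False by (simp add: prod.atLeast_Suc_atMost)
        also have "\<dots> \<le> a (Suc n) * T k"
          using Suc.prems(2) k False T0 by (intro mult_right_mono mono_onD[OF Suc.prems(2)]) auto
        finally have "2 ^ n * T (k - 1) \<le> 2 ^ n * (a (Suc n) * T k)" by simp
        with IH(2)[of "k - 1"] have "E (k - 1) \<le> 2 ^ n * (a (Suc n) * T k)"
          using k by linarith
        then show ?thesis using False by simp
      qed (use a T0 in auto)
      moreover have "a (Suc n) * T k \<le> a (Suc n) * E k" "a (Suc n) * E k \<le> a (Suc n) * (2 ^ n * T k)"
        using IH[OF k] a by (auto intro: mult_left_mono)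
      ultimately show ?thesis using E0 unfolding coeff Tk by (auto simp: algebra_simps)
    qed
  qed
  then show "(\<Prod>j=k+1..n. a j) \<le> coeff (\<Prod>j=1..n. [:a j, 1:]) k"
    "coeff (\<Prod>j=1..n. [:a j, 1:]) k \<le> 2 ^ n * (\<Prod>j=k+1..n. a j)" by auto
qed

text \<open>The two tails differ by \<open>e\<close> consecutive factors, each between the first and
  the last of them. The bounds are multiplicative rather than quotients because a tail may
  vanish.\<close>

lemma prod_tail_bounds:
  fixes a :: "nat \<Rightarrow> real"
  assumes "\<And>j. j \<in> {1..n} \<Longrightarrow> a j \<ge> 0" "mono_on {1..n} a" "k + e \<le> n" "e \<ge> 1"
  shows "a (k + 1) ^ e * (\<Prod>j=k+e+1..n. a j) \<le> (\<Prod>j=k+1..n. a j)"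
    and "(\<Prod>j=k+1..n. a j) \<le> a (k + e) ^ e * (\<Prod>j=k+e+1..n. a j)"
proof -
  have split: "(\<Prod>j=k+1..n. a j) = (\<Prod>j=k+1..k+e. a j) * (\<Prod>j=k+e+1..n. a j)"
    using assms(3,4) by (subst prod.union_disjoint[symmetric]) (auto intro!: prod.cong)
  have T: "(\<Prod>j=k+e+1..n. a j) \<ge> 0" using assms(1) by (intro prod_nonneg) auto
  have "(\<Prod>j=k+1..k+e. a (k+1)) \<le> (\<Prod>j=k+1..k+e. a j)"
    using assms by (intro prod_mono) (auto intro!: mono_onD[OF assms(2)])
  then show "a (k + 1) ^ e * (\<Prod>j=k+e+1..n. a j) \<le> (\<Prod>j=k+1..n. a j)"
    unfolding split by (intro mult_right_mono T) simp
  have "(\<Prod>j=k+1..k+e. a j) \<le> (\<Prod>j=k+1..k+e. a (k+e))"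
    using assms by (intro prod_mono) (auto intro!: mono_onD[OF assms(2)])
  then show "(\<Prod>j=k+1..n. a j) \<le> a (k + e) ^ e * (\<Prod>j=k+e+1..n. a j)"
    unfolding split by (intro mult_right_mono T) simp
qed

text \<open>The two families play symmetric roles, so that one lemma yields both the upper and the
  lower bound on the roots of the derivative after an exchange. The constants stand for the factors
  that differentiation puts between corresponding coefficients.\<close>

lemma compare_roots_via_coeffs:
  fixes y b :: "nat \<Rightarrow> real"
  assumes y: "\<And>j. j \<in> {1..N} \<Longrightarrow> y j \<ge> 0" "mono_on {1..N} y" "k + e \<le> N"
    and b: "\<And>j. j \<in> {1..M} \<Longrightarrow> b j \<ge> 0" "mono_on {1..M} b" "K + e \<le> M"
    and "e \<ge> 1" and pos: "c > 0" "c' > 0" "d > 0" "d' > 0"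
    and eq: "c * coeff (\<Prod>j=1..N. [:y j, 1:]) k = d * coeff (\<Prod>j=1..M. [:b j, 1:]) K"
      "c' * coeff (\<Prod>j=1..N. [:y j, 1:]) (k + e) = d' * coeff (\<Prod>j=1..M. [:b j, 1:]) (K + e)"
  shows "y (k + 1) ^ e * (c * d') \<le> 2 ^ (N + M) * b (K + e) ^ e * (d * c')"
proof -
  define Ty where "Ty = (\<lambda>k. \<Prod>j=k+1..N. y j)"
  define Tb where "Tb = (\<lambda>k. \<Prod>j=k+1..M. b j)"
  define Ey where "Ey = coeff (\<Prod>j=1..N. [:y j, 1:])"
  define Eb where "Eb = coeff (\<Prod>j=1..M. [:b j, 1:])"
  note eq = eq[folded Ey_def Eb_def]
  have b0: "b (K + e) \<ge> 0" using b \<open>e \<ge> 1\<close> by auto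
  have y0: "y (k + 1) \<ge> 0" using y \<open>e \<ge> 1\<close> by auto
  have Ty0: "Ty (k + e) \<ge> 0" unfolding Ty_def using y(1) by (auto intro!: prod_nonneg)
  show ?thesis
  \<comment> \<open>The estimates below end with a cancellation of \<open>Ty (k + e)\<close>. If it
    vanishes, some later \<open>y j\<close> is 0, hence by sortedness so is
    \<open>y (k + 1)\<close>.\<close>
  proof (cases "Ty (k + e) = 0")
    case True
    then obtain j where j: "j \<in> {k+e+1..N}" "y j = 0" unfolding Ty_def by (auto simp: prod_zero_iff)
    then have "y (k + 1) \<le> 0" using mono_onD[OF y(2), of "k + 1" j] by auto
    then have "y (k + 1) = 0" using y0 by simp
    then show ?thesis using \<open>e \<ge> 1\<close> pos b0 by (simp add: power_0_left)
  next
    case False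
    then have Ty: "Ty (k + e) > 0" using Ty0 by simp
    \<comment> \<open>Passing from \<open>y\<close> to \<open>b\<close> at index \<open>k\<close>
      costs \<open>2 ^ M\<close>; passing back at index \<open>k + e\<close>, in the second chain,
      costs \<open>2 ^ N\<close>.\<close>
    have "c * (y (k + 1) ^ e * Ty (k + e)) \<le> c * Ty k"
      using prod_tail_bounds(1)[OF y \<open>e \<ge> 1\<close>] pos unfolding Ty_def by (intro mult_left_mono) auto
    also have "\<dots> \<le> c * Ey k"
      using coeff_prod_linear_bounds(1)[OF y(1,2), of k] y(3) pos
      unfolding Ty_def Ey_def by (intro mult_left_mono) auto
    also have "\<dots> = d * Eb K" by (rule eq)
    also have "\<dots> \<le> d * (2 ^ M * Tb K)"
      using coeff_prod_linear_bounds(2)[OF b(1,2), of K] b(3) pos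
      unfolding Tb_def Eb_def by (intro mult_left_mono) auto
    also have "\<dots> \<le> d * (2 ^ M * (b (K + e) ^ e * Tb (K + e)))"
      using prod_tail_bounds(2)[OF b \<open>e \<ge> 1\<close>] pos unfolding Tb_def by (intro mult_left_mono) auto
    also have "\<dots> \<le> d * (2 ^ M * (b (K + e) ^ e * Eb (K + e)))"
      using coeff_prod_linear_bounds(1)[OF b(1,2), of "K + e"] b(3) b0 pos
      unfolding Tb_def Eb_def by (intro mult_left_mono) auto
    finally have "d' * (c * (y (k + 1) ^ e * Ty (k + e))) \<le> d' * (d * (2 ^ M * (b (K + e) ^ e * Eb (K + e))))"
      using pos by (intro mult_left_mono) auto
    also have "\<dots> = d * (2 ^ M * b (K + e) ^ e) * (c' * Ey (k + e))"
      unfolding eq by (simp add: mult_ac)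
    also have "\<dots> \<le> d * (2 ^ M * b (K + e) ^ e) * (c' * (2 ^ N * Ty (k + e)))"
      using coeff_prod_linear_bounds(2)[OF y(1,2), of "k + e"] y(3) b0 pos
      unfolding Ty_def Ey_def by (intro mult_left_mono) auto
    finally have "(y (k + 1) ^ e * (c * d')) * Ty (k + e) \<le>
        (2 ^ (N + M) * b (K + e) ^ e * (d * c')) * Ty (k + e)"
      by (simp add: power_add mult_ac)
    then show ?thesis using Ty by (rule mult_right_le_imp_le)
  qed
qed

text \<open>The sign is that of \<open>(-1) ^ (n - k)\<close>, written without natural subtraction.
  Once it is removed by taking moduli, only elementary symmetric polynomials of the
  \<open>r j ^ m\<close> remain, and these are nonnegative for nonnegative
  \<open>r j\<close>.\<close>

lemma coeff_poly_nm:
  assumes "m > 0"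
  shows "coeff (poly_nm n m r) (m * k) =
    (-1) ^ (n + k) * of_real (coeff (\<Prod>j=1..n. [:r j ^ m, 1:]) k)"
proof (induction n arbitrary: k)
  case 0
  then show ?case using assms by (cases k) (auto simp: poly_nm_def)
next
  case (Suc n)
  define a where "a = r (Suc n) ^ m"
  have p: "poly_nm (Suc n) m r = monom 1 m * poly_nm n m r - smult (of_real a) (poly_nm n m r)"
    by (simp add: poly_nm_def prod.nat_ivl_Suc' algebra_simps a_def)
  have q: "(\<Prod>j=1..Suc n. [:r j ^ m, 1:]) = [:a, 1:] * (\<Prod>j=1..n. [:r j ^ m, 1:])"
    unfolding a_def by (rule prod.nat_ivl_Suc') simp
  have c: "coeff (poly_nm (Suc n) m r) (m * k) =
      (if k = 0 then 0 else coeff (poly_nm n m r) (m * (k - 1))) - of_real a * coeff (poly_nm n m r) (m * k)"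
  proof -
    have "m * (k - 1) = m * k - m" by (simp add: diff_mult_distrib2)
    then show ?thesis unfolding p using assms
      by (cases k) (auto simp: coeff_monom_mult)
  qed
  show ?case unfolding c q coeff_linear_times Suc.IH
    by (cases k) (auto simp: algebra_simps)
qed

text \<open>For \<open>l \<le> b\<close> this is \<open>b (b - 1) ... (b - l + 1)\<close>, the
  factor that \<open>l\<close> derivatives put in front of the power \<open>b - l\<close>. Truncated
  subtraction makes it positive for all arguments.\<close>

definition falling_fact :: "nat \<Rightarrow> nat \<Rightarrow> real" where
  "falling_fact l b = fact b / fact (b - l)"

lemma falling_fact_pos: "falling_fact l b > 0"
  by (simp add: falling_fact_def)

lemma pochhammer_eq_falling_fact:
  "pochhammer (of_nat (Suc i)) l = (of_real (falling_fact l (i + l)) :: 'a::real_normed_field)"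
proof (induction l)
  case (Suc l)
  have "falling_fact (Suc l) (i + Suc l) = falling_fact l (i + l) * (1 + real i + real l)"
    by (simp add: falling_fact_def algebra_simps)
  then show ?case using Suc by (simp add: pochhammer_Suc)
qed (simp add: falling_fact_def)

lemma falling_fact_Suc:
  assumes "l \<le> b"
  shows "falling_fact l b = falling_fact l (Suc b) * (1 - real l / real (Suc b))"
proof -
  have "Suc b - l = Suc (b - l)" using assms by simp
  moreover have "real (Suc b - l) = real (Suc b) - real l" using assms by simp
  ultimately show ?thesis
    by (simp add: falling_fact_def divide_simps of_nat_diff[OF assms] del: of_nat_Suc)
qed

text \<open>The quotient of the two values is the product of \<open>1 - l / i\<close> over
  \<open>a < i \<le> b\<close>, and these factors increase with \<open>i\<close>.\<close>

lemma falling_fact_bounds: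
  assumes "l \<le> a" "a \<le> b" "a > 0"
  shows "falling_fact l a \<le> (1 - real l / real b) ^ (b - a) * falling_fact l b"
    and "(1 - real l / real a) ^ (b - a) * falling_fact l b \<le> falling_fact l a"
proof -
  have "falling_fact l a \<le> (1 - real l / real b) ^ (b - a) * falling_fact l b \<and>
    (1 - real l / real a) ^ (b - a) * falling_fact l b \<le> falling_fact l a"
    using assms(2)
  proof (induction b rule: dec_induct)
    case (step i)
    have le: "0 \<le> 1 - real l / real a" "0 \<le> 1 - real l / real i"
      "1 - real l / real a \<le> 1 - real l / real (Suc i)"
      "1 - real l / real i \<le> 1 - real l / real (Suc i)"
      using assms step.hyps by (auto simp: divide_le_eq_1 simp del: of_nat_Suc intro!: frac_le)
    have Suc: "Suc i - a = Suc (i - a)" using step.hyps by simp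
    have F: "falling_fact l i = falling_fact l (Suc i) * (1 - real l / real (Suc i))"
      using assms step.hyps by (intro falling_fact_Suc) auto
    have "falling_fact l a \<le> (1 - real l / real i) ^ (i - a) * falling_fact l i" using step by simp
    also have "\<dots> \<le> (1 - real l / real (Suc i)) ^ (i - a) * falling_fact l i"
      using le falling_fact_pos[of l i] by (intro mult_right_mono power_mono) auto
    also have "\<dots> = (1 - real l / real (Suc i)) ^ (Suc i - a) * falling_fact l (Suc i)"
      unfolding F Suc by simp
    finally have 1: "falling_fact l a \<le> \<dots>" .
    have "(1 - real l / real a) ^ (Suc i - a) * falling_fact l (Suc i) =
        (1 - real l / real a) ^ (i - a) * ((1 - real l / real a) * falling_fact l (Suc i))"
      unfolding Suc by simp
    also have "\<dots> \<le> (1 - real l / real a) ^ (i - a) * ((1 - real l / real (Suc i)) * falling_fact l (Suc i))"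
      using le falling_fact_pos[of l "Suc i"] by (intro mult_left_mono mult_right_mono) auto
    also have "\<dots> = (1 - real l / real a) ^ (i - a) * falling_fact l i"
      unfolding F by (simp add: mult_ac)
    also have "\<dots> \<le> falling_fact l a" using step by simp
    finally show ?case using 1 by simp
  qed simp
  then show "falling_fact l a \<le> (1 - real l / real b) ^ (b - a) * falling_fact l b"
    "(1 - real l / real a) ^ (b - a) * falling_fact l b \<le> falling_fact l a" by auto
qed

text \<open>Both sides come from the coefficient of \<open>z ^ (m k + s)\<close> in the derivative.
  The degree identity gives \<open>m k + s + l = m (k + (n - N))\<close>, which is where the index
  shift originates; moduli discard the signs and the argument of \<open>C\<close>.\<close>

lemma coeff_higher_pderiv_poly_nm:
  assumes "m > 0" "s + m * N + l = m * n" "k \<le> N"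
    and eq: "(pderiv ^^ l) (poly_nm n m r) = smult C (monom 1 s * poly_nm N m x)"
    and r: "\<And>j. j \<in> {1..n} \<Longrightarrow> r j \<ge> 0" "mono_on {1..n} r"
    and x: "\<And>j. j \<in> {1..N} \<Longrightarrow> x j \<ge> 0" "mono_on {1..N} x"
  shows "cmod C * coeff (\<Prod>j=1..N. [:x j ^ m, 1:]) k =
    falling_fact l (m * (k + (n - N))) * coeff (\<Prod>j=1..n. [:r j ^ m, 1:]) (k + (n - N))"
proof -
  have nn: "coeff (\<Prod>j=1..n'. [:a j ^ m, 1:]) k' \<ge> 0"
    if "\<And>j. j \<in> {1..n'} \<Longrightarrow> a j \<ge> 0" "mono_on {1..n'} a" "k' \<le> n'" for a :: "nat \<Rightarrow> real" and k' n'
  proof -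
    have "mono_on {1..n'} (\<lambda>j. a j ^ m)"
      using that by (auto simp: mono_on_def intro!: power_mono)
    then have "coeff (\<Prod>j=1..n'. [:a j ^ m, 1:]) k' \<ge> (\<Prod>j=k'+1..n'. a j ^ m)"
      using that by (intro coeff_prod_linear_bounds(1)) auto
    moreover have "(\<Prod>j=k'+1..n'. a j ^ m) \<ge> 0"
      using that by (intro prod_nonneg) auto
    ultimately show ?thesis by linarith
  qed
  have "m * N \<le> m * n" using assms(2) by linarith
  then have Nn: "N \<le> n" using assms(1) by simp
  have ix: "m * k + s + l = m * (k + (n - N))"
    using assms(2) Nn by (simp add: algebra_simps diff_mult_distrib2)
  have "coeff ((pderiv ^^ l) (poly_nm n m r)) (m * k + s) =
      of_real (falling_fact l (m * (k + (n - N)))) * coeff (poly_nm n m r) (m * (k + (n - N)))"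
    unfolding coeff_higher_pderiv pochhammer_eq_falling_fact ix ..
  moreover have "coeff ((pderiv ^^ l) (poly_nm n m r)) (m * k + s) = C * coeff (poly_nm N m x) (m * k)"
    unfolding eq by (simp add: coeff_monom_mult)
  ultimately have "cmod (C * coeff (poly_nm N m x) (m * k)) =
     cmod (of_real (falling_fact l (m * (k + (n - N)))) * coeff (poly_nm n m r) (m * (k + (n - N))))"
    by simp
  then show ?thesis
    using nn[OF x assms(3)] nn[OF r, of "k + (n - N)"] assms(3) Nn falling_fact_pos[of l "m * (k + (n - N))"]
    unfolding coeff_poly_nm[OF assms(1)] by (simp add: norm_mult norm_power)
qed

section \<open>Extraction of roots from the coefficient comparison\<close>

lemma le_powr_times_if_power_le:
  fixes u v :: real
  assumes "u ^ p \<le> 4 ^ n * v ^ p" "v \<ge> 0" "p > 0"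
  shows "u \<le> 4 powr (real n / real p) * v"
proof (rule power_le_imp_le_base)
  have "(4 powr (real n / real p)) ^ p = 4 powr (real n)"
    using assms(3) by (simp add: powr_power)
  then have "(4 powr (real n / real p) * v) ^ p = 4 ^ n * v ^ p"
    by (simp add: power_mult_distrib powr_realpow)
  then show "u ^ Suc (p - 1) \<le> (4 powr (real n / real p) * v) ^ Suc (p - 1)"
    using assms by simp
qed (use assms in auto)

text \<open>Two applications of \<open>compare_roots_via_coeffs\<close> with the families exchanged.
  The falling factorials at \<open>m K\<close> and \<open>m (K + e)\<close> are \<open>m e\<close>
  steps apart, so their quotient is bounded by exact \<open>(m e)\<close>-th powers and the root
  extraction leaves a linear factor. \<open>N < n\<close> makes the shifted index positive even for
  \<open>k = 0\<close>.\<close>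

lemma higher_pderiv_root_bounds:
  assumes "m > 0" "s < m" "s + m * N + l = m * n" "C \<noteq> 0"
    and eq: "(pderiv ^^ l) (poly_nm n m r) = smult C (monom 1 s * poly_nm N m x)"
    and r: "\<And>j. j \<in> {1..n} \<Longrightarrow> r j \<ge> 0" "mono_on {1..n} r"
    and x: "\<And>j. j \<in> {1..N} \<Longrightarrow> x j \<ge> 0" "mono_on {1..N} x"
    and k: "k + e \<le> N" "e \<ge> 1" "N < n"
  shows "x (k + 1) \<le> 4 powr (real n / real (m * e)) *
      (r (k + (n - N) + e) * (1 - real l / real (m * (k + (n - N) + e))))"
    and "r (k + (n - N) + 1) * (1 - real l / real (m * (k + (n - N)))) \<le>
      4 powr (real n / real (m * e)) * x (k + e)"
proof -
  define K where "K = k + (n - N)"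
  define F where "F = falling_fact l"
  have F: "F i > 0" for i unfolding F_def by (rule falling_fact_pos)
  have Ke: "k + e + (n - N) = K + e" "K + e \<le> n" "K > 0" unfolding K_def using k by auto
  \<comment> \<open>Hence every power \<open>m K\<close> that occurs is at least \<open>l\<close>:
    the falling factorials are genuine and the factors \<open>1 - l / (m K)\<close> are
    nonnegative.\<close>
  have Nn: "m * (n - N) = l + s" using assms(3) k by (simp add: diff_mult_distrib2)
  have "m * (n - N) \<le> m * K" unfolding K_def by simp
  then have lK: "l \<le> m * K" "l \<le> m * (K + e)" "m * K > 0" using Nn Ke assms(1) by (auto simp: algebra_simps)
  note co = coeff_higher_pderiv_poly_nm[OF assms(1,3) _ eq r x]
  have mono: "mono_on {1..n} (\<lambda>j. r j ^ m)" "mono_on {1..N} (\<lambda>j. x j ^ m)"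
    using r x by (auto simp: mono_on_def intro!: power_mono)
  have nn: "j \<in> {1..n} \<Longrightarrow> r j ^ m \<ge> 0" "j \<in> {1..N} \<Longrightarrow> x j ^ m \<ge> 0" for j
    using r x by auto
  have e1: "cmod C * coeff (\<Prod>j=1..N. [:x j ^ m, 1:]) k = F (m * K) * coeff (\<Prod>j=1..n. [:r j ^ m, 1:]) K"
    using co[of k] k unfolding F_def K_def by simp
  have e2: "cmod C * coeff (\<Prod>j=1..N. [:x j ^ m, 1:]) (k + e) =
      F (m * (K + e)) * coeff (\<Prod>j=1..n. [:r j ^ m, 1:]) (K + e)"
    using co[of "k + e"] k unfolding F_def Ke by simp
  have C: "cmod C > 0" using assms(4) by simp
  have r0: "r (K + e) \<ge> 0" "r (K + 1) \<ge> 0" and x0: "x (k + e) \<ge> 0" "x (k + 1) \<ge> 0"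
    using r x k Ke by auto
  have p: "(2 :: real) ^ (N + n) \<le> 4 ^ n"
  proof -
    have "(2 :: real) ^ (N + n) \<le> 2 ^ (2 * n)" using k by (intro power_increasing) auto
    then show ?thesis by (simp add: power_mult)
  qed
  have me: "m * (K + e) - m * K = m * e" by (simp add: algebra_simps)
  have le0: "1 - real l / real (m * (K + e)) \<ge> 0" "1 - real l / real (m * K) \<ge> 0"
    using lK by (auto simp: divide_simps simp del: of_nat_mult)
  have "(x (k + 1) ^ m) ^ e * (cmod C * F (m * (K + e))) \<le>
      2 ^ (N + n) * (r (K + e) ^ m) ^ e * (F (m * K) * cmod C)"
    using e1 e2 k(1) C F nn mono Ke k by (intro compare_roots_via_coeffs[where y = "\<lambda>j. x j ^ m" and b = "\<lambda>j. r j ^ m"]) auto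
  then have "x (k + 1) ^ (m * e) * F (m * (K + e)) \<le> 2 ^ (N + n) * r (K + e) ^ (m * e) * F (m * K)"
    using C by (simp add: mult_ac flip: power_mult)
  also have "\<dots> \<le> 4 ^ n * r (K + e) ^ (m * e) *
      ((1 - real l / real (m * (K + e))) ^ (m * e) * F (m * (K + e)))"
    using falling_fact_bounds(1)[of l "m * K" "m * (K + e)"] lK p r0 F[of "m * K"]
    unfolding me F_def[symmetric] by (intro mult_mono mult_nonneg_nonneg zero_le_power) auto
  finally have "x (k + 1) ^ (m * e) \<le> 4 ^ n * (r (K + e) * (1 - real l / real (m * (K + e)))) ^ (m * e)"
    using F[of "m * (K + e)"] by (simp add: power_mult_distrib mult_ac del: of_nat_mult of_nat_add)
  then show "x (k + 1) \<le> 4 powr (real n / real (m * e)) *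
      (r (k + (n - N) + e) * (1 - real l / real (m * (k + (n - N) + e))))"
    unfolding K_def[symmetric] using r0 le0 assms(1) k
    by (intro le_powr_times_if_power_le mult_nonneg_nonneg) auto
  have "(r (K + 1) ^ m) ^ e * (F (m * K) * cmod C) \<le>
      2 ^ (n + N) * (x (k + e) ^ m) ^ e * (cmod C * F (m * (K + e)))"
    using e1 e2 k(1) C F nn mono Ke k by (intro compare_roots_via_coeffs[where b = "\<lambda>j. x j ^ m" and y = "\<lambda>j. r j ^ m"]) auto
  then have *: "r (K + 1) ^ (m * e) * F (m * K) \<le> 2 ^ (N + n) * x (k + e) ^ (m * e) * F (m * (K + e))"
    using C by (simp add: mult_ac add.commute flip: power_mult)
  have "r (K + 1) ^ (m * e) * ((1 - real l / real (m * K)) ^ (m * e) * F (m * (K + e))) \<le>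
      r (K + 1) ^ (m * e) * F (m * K)"
    using falling_fact_bounds(2)[of l "m * K" "m * (K + e)"] lK r0
    unfolding me F_def[symmetric] by (intro mult_left_mono zero_le_power) auto
  also note *
  also have "2 ^ (N + n) * x (k + e) ^ (m * e) * F (m * (K + e)) \<le> 4 ^ n * x (k + e) ^ (m * e) * F (m * (K + e))"
    using p x0 F[of "m * (K + e)"] by (intro mult_right_mono zero_le_power) auto
  finally have "(r (K + 1) * (1 - real l / real (m * K))) ^ (m * e) \<le> 4 ^ n * x (k + e) ^ (m * e)"
    using F[of "m * (K + e)"] by (simp add: power_mult_distrib mult_ac del: of_nat_mult of_nat_add)
  then show "r (k + (n - N) + 1) * (1 - real l / real (m * (k + (n - N)))) \<le>
      4 powr (real n / real (m * e)) * x (k + e)"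
    unfolding K_def[symmetric] using x0 assms(1) k
    by (intro le_powr_times_if_power_le) auto
qed

section \<open>Averages and integrals\<close>

lemma integral_empirical_measure:
  fixes f :: "'a::topological_space \<Rightarrow> real"
  assumes "X \<noteq> {#}" and [measurable]: "f \<in> borel_measurable borel"
  shows "(\<integral>x. f x \<partial>empirical_measure X) = (\<Sum>x\<in>#X. f x) / size X"
proof -
  have "(\<integral>x. f x \<partial>empirical_measure X) = (\<integral>x. f x \<partial>measure_pmf (pmf_of_multiset X))"
    unfolding empirical_measure_def by (subst integral_distr) auto
  also have "\<dots> = (\<Sum>x\<in>set_mset X. f x * pmf (pmf_of_multiset X) x)"
    using assms by (intro integral_measure_pmf_real) auto
  also have "\<dots> = (\<Sum>x\<in>#X. f x) / size X"
    using assms by (simp add: sum_mset_eq_sum_count sum_divide_distrib mult.commute)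
  finally show ?thesis .
qed

lemma integral_root_measure_poly_nm:
  fixes f :: "complex \<Rightarrow> real"
  assumes "C \<noteq> 0" "m > 0" "s + m * N > 0" and f: "f \<in> borel_measurable borel"
  shows "(\<integral>z. f z \<partial>root_measure (smult C (monom 1 s * poly_nm N m x))) =
    (real s * f 0 + (\<Sum>j=1..N. \<Sum>k<m. f (of_real (x j) * cis (2 * pi * (real k / real m))))) / real (s + m * N)"
proof -
  define w where "w = (\<lambda>j k. of_real (x j) * cis (2 * pi * (real k / real m)))"
  have "of_real (x j) * exp (2 * of_real pi * \<i> * of_nat k / of_nat m) = w j k" for j k
    by (simp add: w_def cis_conv_exp mult_ac)
  then have p: "poly_nm N m x = (\<Prod>j=1..N. \<Prod>k<m. [:- w j k, 1:])"
    using poly_nm_eq_prod_linear[of m N x] assms(2) by simp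
  define X where "X = replicate_mset s 0 + (\<Sum>j=1..N. \<Sum>k<m. {#w j k#})"
  have ne: "(\<Prod>k<m. [:- w j k, 1:]) \<noteq> 0" for j by (simp add: prod_zero_iff)
  have ne': "poly_nm N m x \<noteq> 0" unfolding p by (simp add: prod_zero_iff)
  have mon: "proots (monom 1 s :: complex poly) = replicate_mset s 0"
  proof -
    have "monom 1 s = ([:- 0, 1:] :: complex poly) ^ s" by (simp add: monom_altdef)
    then show ?thesis by (simp only: proots_power proots_linear_factor) simp
  qed
  have X: "proots (smult C (monom 1 s * poly_nm N m x)) = X"
  proof -
    have "proots (smult C (monom 1 s * poly_nm N m x)) = replicate_mset s 0 + proots (poly_nm N m x)"
      using assms(1) ne' by (simp add: proots_mult mon monom_eq_0_iff)
    also have "proots (poly_nm N m x) = (\<Sum>j=1..N. proots (\<Prod>k<m. [:- w j k, 1:]))"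
      unfolding p using ne by (intro proots_prod) auto
    also have "\<dots> = (\<Sum>j=1..N. \<Sum>k<m. {#w j k#})"
      by (intro sum.cong refl) (subst proots_prod; auto)
    finally show ?thesis unfolding X_def .
  qed
  have sz: "size X = s + m * N"
  proof -
    have *: "size (sum Y I) = (\<Sum>i\<in>I. size (Y i))" for Y :: "nat \<Rightarrow> complex multiset" and I
      by (induction I rule: infinite_finite_induct) auto
    show ?thesis unfolding X_def by (simp add: * mult.commute)
  qed
  have "(\<Sum>z\<in>#X. f z) = real s * f 0 + (\<Sum>j=1..N. \<Sum>k<m. f (w j k))"
  proof -
    have *: "(\<Sum>z\<in>#sum M I. f z) = (\<Sum>i\<in>I. \<Sum>z\<in>#M i. f z)" for M and I :: "nat set"
      by (induction I rule: infinite_finite_induct) auto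
    show ?thesis unfolding X_def by (simp add: *)
  qed
  moreover have "X \<noteq> {#}" using sz assms(3) by auto
  ultimately show ?thesis
    unfolding root_measure_def X using f by (simp add: integral_empirical_measure sz w_def)
qed

text \<open>The ceiling of \<open>u M\<close> equals \<open>j\<close> exactly on the cell from
  \<open>(j - 1) / M\<close> (excluded) to \<open>j / M\<close> (included); these cells partition
  \<open>(0, 1]\<close> and are numbered from 1, like the roots.\<close>

lemma integral_step_function:
  fixes h :: "nat \<Rightarrow> real"
  assumes "M > 0"
  shows "(LINT u:{0<..1}|lborel. h (nat \<lceil>u * real M\<rceil>)) = (\<Sum>j=1..M. h j) / real M"
proof -
  define I where "I = (\<lambda>j. {(real j - 1) / real M <.. real j / real M})"
  have eq: "indicator {0<..1} u *\<^sub>R h (nat \<lceil>u * real M\<rceil>) = (\<Sum>j=1..M. indicator (I j) u *\<^sub>R h j)" for u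
  proof -
    define i where "i = nat \<lceil>u * real M\<rceil>"
    have iff: "u \<in> I j \<longleftrightarrow> \<lceil>u * real M\<rceil> = int j" for j
      using assms unfolding I_def by (auto simp: ceiling_eq_iff divide_simps)
    have "u \<in> {0<..1} \<longleftrightarrow> 0 < \<lceil>u * real M\<rceil> \<and> \<lceil>u * real M\<rceil> \<le> int M"
      using assms by (auto simp: ceiling_le_iff zero_less_mult_iff)
    also have "\<dots> \<longleftrightarrow> i \<in> {1..M} \<and> \<lceil>u * real M\<rceil> = int i"
    proof -
      have "0 < z \<and> z \<le> int M \<longleftrightarrow> nat z \<in> {1..M} \<and> z = int (nat z)" for z by auto
      then show ?thesis unfolding i_def .
    qed
    finally have dom: "u \<in> {0<..1} \<longleftrightarrow> i \<in> {1..M} \<and> \<lceil>u * real M\<rceil> = int i" .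
    show ?thesis
    proof (cases "u \<in> {0<..1}")
      case True
      then have i: "i \<in> {1..M}" "\<lceil>u * real M\<rceil> = int i" using dom by auto
      have "(\<Sum>j=1..M. indicator (I j) u *\<^sub>R h j) = (\<Sum>j=1..M. if j = i then h j else 0)"
        by (intro sum.cong refl) (auto simp: indicator_def iff i)
      then show ?thesis using i(1) True by (simp flip: i_def)
    next
      case False
      have "\<not> u \<in> I j" if j: "j \<in> {1..M}" for j
      proof
        assume "u \<in> I j"
        then have "\<lceil>u * real M\<rceil> = int j" unfolding iff .
        moreover from this have "i = j" unfolding i_def by simp
        ultimately show False using dom False j by blast
      qed
      then show ?thesis using False by simp
    qed
  qed
  have "integrable lborel (\<lambda>u. indicator (I j) u *\<^sub>R h j)" for j
    unfolding I_def by (intro integrable_scaleR_left integrable_real_indicator) (auto simp: divide_right_mono)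
  then have "(LINT u:{0<..1}|lborel. h (nat \<lceil>u * real M\<rceil>)) = (\<Sum>j=1..M. LINT u|lborel. indicator (I j) u *\<^sub>R h j)"
    unfolding set_lebesgue_integral_def eq by (intro Bochner_Integration.integral_sum) auto
  also have "\<dots> = (\<Sum>j=1..M. h j / real M)"
  proof (intro sum.cong refl)
    fix j
    have "measure lborel (I j) = real j / real M - (real j - 1) / real M"
      unfolding I_def by (subst measure_lborel_Ioc) (auto simp: divide_right_mono)
    then have "measure lborel (I j) = 1 / real M" by (simp add: diff_divide_distrib)
    then show "(LINT u|lborel. indicator (I j) u *\<^sub>R h j) = h j / real M"
      by (simp add: I_def)
  qed
  finally show ?thesis by (simp add: sum_divide_distrib)
qed

text \<open>
  An average is the integral over \<open>(0, 1]\<close> of a step function, so dominated convergence applies.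
\<close>

lemma average_tendsto_integral:
  fixes h :: "nat \<Rightarrow> nat \<Rightarrow> real" and g :: "real \<Rightarrow> real"
  assumes "\<forall>\<^sub>F n in sequentially. M n > 0" "\<And>n j. \<bar>h n j\<bar> \<le> B"
    and [measurable]: "g \<in> borel_measurable borel"
    and lim: "AE u in lborel. u \<in> {0<..<1} \<longrightarrow> (\<lambda>n. h n (nat \<lceil>u * real (M n)\<rceil>)) \<longlonglongrightarrow> g u"
  shows "(\<lambda>n. (\<Sum>j=1..M n. h n j) / real (M n)) \<longlonglongrightarrow> (LINT u:{0<..1}|lborel. g u)"
proof (rule Lim_transform_eventually)
  have [measurable]: "h n \<in> borel_measurable (count_space UNIV)" for n by simp
  \<comment> \<open>No limit is assumed at the right endpoint, which belongs to the domain of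
    integration but is a null set.\<close>
  have 1: "AE u in lborel. u \<noteq> (1::real)" by (rule AE_lborel_singleton)
  show "(\<lambda>n. LINT u:{0<..1}|lborel. h n (nat \<lceil>u * real (M n)\<rceil>)) \<longlonglongrightarrow> (LINT u:{0<..1}|lborel. g u)"
    unfolding set_lebesgue_integral_def
  proof (rule integral_dominated_convergence[where w = "\<lambda>u. indicator {0<..1} u *\<^sub>R B"])
    show "integrable lborel (\<lambda>u::real. indicator {0<..1} u *\<^sub>R B)"
      by (intro integrable_scaleR_left integrable_real_indicator) auto
    show "AE u in lborel. norm (indicator {0<..1} u *\<^sub>R h n (nat \<lceil>u * real (M n)\<rceil>)) \<le> indicator {0<..1} u *\<^sub>R B" for n
      using assms(2) by (auto simp: indicator_def)
    show "AE u in lborel. (\<lambda>n. indicator {0<..1} u *\<^sub>R h n (nat \<lceil>u * real (M n)\<rceil>)) \<longlonglongrightarrow> indicator {0<..1} u *\<^sub>R g u"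
      using lim 1
    proof eventually_elim
      case (elim u)
      then show ?case by (cases "u \<in> {0<..<1}") (auto simp: indicator_def)
    qed
  qed measurable
  show "\<forall>\<^sub>F n in sequentially. (LINT u:{0<..1}|lborel. h n (nat \<lceil>u * real (M n)\<rceil>)) =
      (\<Sum>j=1..M n. h n j) / real (M n)"
    using assms(1) by eventually_elim (rule integral_step_function)
qed

text \<open>\<open>nat\<close> sends negative ceilings to 0, hence the limit
  \<open>max 0 u\<close>.\<close>

lemma tendsto_ceiling_mult_over:
  assumes "filterlim M at_top sequentially"
  shows "(\<lambda>n. real (nat \<lceil>u * real (M n)\<rceil>) / real (M n)) \<longlonglongrightarrow> max 0 u"
proof (rule tendsto_sandwich[where f = "\<lambda>_. max 0 u" and h = "\<lambda>n. max 0 u + 1 / real (M n)"])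
  have M: "(\<lambda>n. 1 / real (M n)) \<longlonglongrightarrow> 0"
    using filterlim_compose[OF lim_inverse_n assms] by (simp add: inverse_eq_divide)
  show "(\<lambda>n. max 0 u + 1 / real (M n)) \<longlonglongrightarrow> max 0 u"
    using tendsto_add[OF tendsto_const M] by simp
  show "(\<lambda>n. max 0 u) \<longlonglongrightarrow> max 0 u" by simp
  have pos: "\<forall>\<^sub>F n in sequentially. M n > 0" using eventually_compose_filterlim[OF eventually_gt_at_top[of 0] assms] .
  show "\<forall>\<^sub>F n in sequentially. max 0 u \<le> real (nat \<lceil>u * real (M n)\<rceil>) / real (M n)"
    using pos
  proof eventually_elim
    case (elim n)
    then have "max 0 u * real (M n) \<le> real (nat \<lceil>u * real (M n)\<rceil>)"
      using real_nat_ceiling_ge[of "u * real (M n)"] by (auto simp: max_def)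
    then show ?case using elim by (simp only: pos_le_divide_eq of_nat_0_less_iff)
  qed
  show "\<forall>\<^sub>F n in sequentially. real (nat \<lceil>u * real (M n)\<rceil>) / real (M n) \<le> max 0 u + 1 / real (M n)"
    using pos
  proof eventually_elim
    case (elim n)
    have "real (nat \<lceil>u * real (M n)\<rceil>) \<le> max 0 u * real (M n) + 1"
    proof (cases "u \<ge> 0")
      case True
      have "real_of_int \<lceil>u * real (M n)\<rceil> \<le> u * real (M n) + 1" by linarith
      moreover have "\<lceil>u * real (M n)\<rceil> \<ge> 0" using True
        by (metis ceiling_mono ceiling_zero mult_nonneg_nonneg of_nat_0_le_iff)
      ultimately show ?thesis using True by (simp add: max_def)
    next
      case False
      then have "u * real (M n) \<le> 0" by (simp add: mult_nonpos_nonneg)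
      then have "nat \<lceil>u * real (M n)\<rceil> = 0" by (simp add: ceiling_le_iff)
      then show ?thesis by simp
    qed
    then show ?case using elim by (simp add: field_simps)
  qed
qed

section \<open>Equidistribution of roots of unity on circles\<close>

lemma isCont_cis: "isCont cis x"
  using continuous_on_cis[OF continuous_on_id, of UNIV] by (simp add: continuous_on_eq_continuous_at)

text \<open>A Riemann sum on a circle whose radius moves with \<open>n\<close>. The summand may
  depend on \<open>n\<close> in \<open>average_tendsto_integral\<close>, so continuity of
  \<open>f\<close> absorbs the moving radius together with the discretized angle.\<close>

lemma circle_average_tendsto:
  fixes f :: "complex \<Rightarrow> real"
  assumes m: "filterlim m at_top sequentially" and f: "continuous_on UNIV f" "\<And>z. \<bar>f z\<bar> \<le> B"
    and x: "x \<longlonglongrightarrow> (y :: real)"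
  shows "(\<lambda>n. (\<Sum>k<m n. f (of_real (x n) * cis (2 * pi * (real k / real (m n))))) / real (m n))
    \<longlonglongrightarrow> (LINT u:{0<..1}|lborel. f (of_real y * cis (2 * pi * u)))"
proof -
  \<comment> \<open>Roots of unity are counted from 0, averages from 1. The resulting offset of the
    angle is \<open>1 / m n\<close>, which vanishes in the limit.\<close>
  have shift: "(\<Sum>k<m n. f (of_real (x n) * cis (2 * pi * (real k / real (m n))))) =
      (\<Sum>j=1..m n. f (of_real (x n) * cis (2 * pi * (real (j - 1) / real (m n)))))" for n
    by (rule sum.reindex_bij_witness[of _ "\<lambda>j. j - 1" Suc]) auto
  have inv: "(\<lambda>n. 1 / real (m n)) \<longlonglongrightarrow> 0"
    using filterlim_compose[OF lim_inverse_n m] by (simp add: inverse_eq_divide)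
  have cf: "isCont f z" for z using f(1) by (simp add: continuous_on_eq_continuous_at)
  show ?thesis unfolding shift
  proof (rule average_tendsto_integral[where B = B])
    show "\<forall>\<^sub>F n in sequentially. m n > 0" using eventually_compose_filterlim[OF eventually_gt_at_top[of 0] m] .
    show "(\<lambda>u. f (of_real y * cis (2 * pi * u))) \<in> borel_measurable borel"
      by (intro borel_measurable_continuous_onI continuous_on_compose2[OF f(1)] continuous_intros) auto
    show "AE u in lborel. u \<in> {0<..<1} \<longrightarrow>
        (\<lambda>n. f (of_real (x n) * cis (2 * pi * (real (nat \<lceil>u * real (m n)\<rceil> - 1) / real (m n)))))
          \<longlonglongrightarrow> f (of_real y * cis (2 * pi * u))"
    proof (intro AE_I2 impI)
      fix u :: real assume u: "u \<in> {0<..<1}"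
      have "(\<lambda>n. real (nat \<lceil>u * real (m n)\<rceil>) / real (m n) - 1 / real (m n)) \<longlonglongrightarrow> u - 0"
        using tendsto_ceiling_mult_over[OF m, of u] u by (intro tendsto_diff inv) auto
      moreover have "\<forall>\<^sub>F n in sequentially. real (nat \<lceil>u * real (m n)\<rceil>) / real (m n) - 1 / real (m n) =
          real (nat \<lceil>u * real (m n)\<rceil> - 1) / real (m n)"
      proof -
        have "\<forall>\<^sub>F n in sequentially. m n > 0" using eventually_compose_filterlim[OF eventually_gt_at_top[of 0] m] .
        then show ?thesis
        proof eventually_elim
          case (elim n)
          then have "nat \<lceil>u * real (m n)\<rceil> \<ge> 1" using u by (simp add: Suc_le_eq)
          then show ?case by (simp add: diff_divide_distrib of_nat_diff)
        qed
      qed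
      ultimately have "(\<lambda>n. real (nat \<lceil>u * real (m n)\<rceil> - 1) / real (m n)) \<longlonglongrightarrow> u"
        by (simp add: Lim_transform_eventually)
      then show "(\<lambda>n. f (of_real (x n) * cis (2 * pi * (real (nat \<lceil>u * real (m n)\<rceil> - 1) / real (m n)))))
          \<longlonglongrightarrow> f (of_real y * cis (2 * pi * u))"
        by (intro isCont_tendsto_compose[OF cf] tendsto_mult tendsto_of_real x
            isCont_tendsto_compose[OF isCont_cis] tendsto_const)
    qed
  qed (use f in auto)
qed

section \<open>Integrals against the limit law\<close>

lemma integral_uniform_measure_Icc:
  fixes h :: "real \<Rightarrow> real"
  assumes [measurable]: "h \<in> borel_measurable borel" and "a < b"
  shows "(\<integral>x. h x \<partial>uniform_measure lborel {a..b}) = (LINT u:{0<..1}|lborel. h (a + (b - a) * u))"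
proof -
  have "(\<integral>x. h x \<partial>uniform_measure lborel {a..b}) =
      (\<integral>x. (indicator {a..b} x / (b - a)) *\<^sub>R h x \<partial>lborel)"
  proof -
    have "uniform_measure lborel {a..b} = density lborel (\<lambda>x. ennreal (indicator {a..b} x / (b - a)))"
      unfolding uniform_measure_def using assms(2)
      by (intro density_cong)
        (auto simp: indicator_def divide_ennreal ennreal_1[symmetric] simp del: ennreal_1)
    then show ?thesis using assms(2) by (simp add: integral_density)
  qed
  also have "\<dots> = (b - a) * (\<integral>u. (indicator {a..b} (a + (b - a) * u) / (b - a)) *\<^sub>R h (a + (b - a) * u) \<partial>lborel)"
    using assms(2) by (subst lborel_integral_real_affine[where c = "b - a" and t = a]) auto
  also have "\<dots> = (\<integral>u. (b - a) * ((indicator {a..b} (a + (b - a) * u) / (b - a)) *\<^sub>R h (a + (b - a) * u)) \<partial>lborel)"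
    by simp
  also have "\<dots> = (LINT u:{0<..1}|lborel. h (a + (b - a) * u))"
    unfolding set_lebesgue_integral_def
  proof (rule integral_cong_AE)
    have "AE u in lborel. u \<noteq> (0::real)" by (rule AE_lborel_singleton)
    then show "AE u in lborel. (b - a) * ((indicator {a..b} (a + (b - a) * u) / (b - a)) *\<^sub>R h (a + (b - a) * u)) =
        indicator {0<..1} u *\<^sub>R h (a + (b - a) * u)"
    proof eventually_elim
      case (elim u)
      have "a + (b - a) * u \<in> {a..b} \<longleftrightarrow> (b - a) * 0 \<le> (b - a) * u \<and> (b - a) * u \<le> (b - a) * 1"
        by auto
      also have "\<dots> \<longleftrightarrow> u \<in> {0..1}"
        using assms(2) by (simp only: mult_le_cancel_left_pos diff_gt_0_iff_gt) auto
      finally have "a + (b - a) * u \<in> {a..b} \<longleftrightarrow> u \<in> {0..1}" .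
      then show ?case using assms(2) elim by (auto simp: indicator_def)
    qed
  qed measurable
  finally show ?thesis .
qed

text \<open>Fubini and affine substitutions bring the limit into the same form as the averages over
  the roots: the outer variable is the relative rank of a radius, the inner one the angle as a
  fraction of a full turn.\<close>

lemma integral_radial_measure_nu_t:
  fixes f :: "complex \<Rightarrow> real"
  assumes "real_distribution \<nu>0" "measure \<nu>0 {0..A} = 1" "0 < t" "t < 1"
    and f: "continuous_on UNIV f" "\<And>z. \<bar>f z\<bar> \<le> B"
  shows "(\<integral>z. f z \<partial>radial_measure (nu_t \<nu>0 t)) = (LINT w:{0<..1}|lborel. LINT u:{0<..1}|lborel.
    f (of_real ((1 - t / (t + (1 - t) * w)) * quantile \<nu>0 (t + (1 - t) * w)) * cis (2 * pi * u)))"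
proof -
  have [measurable]: "f \<in> borel_measurable borel" using f(1) by (rule borel_measurable_continuous_onI)
  have [measurable]: "cis \<in> borel_measurable borel"
    by (intro borel_measurable_continuous_onI continuous_intros)
  have q[measurable]: "quantile \<nu>0 \<in> borel_measurable borel"
    using assms by (intro measurable_quantile)
  interpret A: prob_space "nu_t \<nu>0 t" using prob_space_nu_t[OF assms(1-4)] .
  interpret B: prob_space unif_circle by (rule prob_space_unif_circle)
  interpret P: pair_prob_space "nu_t \<nu>0 t" unif_circle ..
  have [measurable_cong]: "sets (nu_t \<nu>0 t) = sets borel" "sets unif_circle = sets borel"
    by (simp_all add: nu_t_def unif_circle_def)
  have "(\<integral>z. f z \<partial>radial_measure (nu_t \<nu>0 t)) =
      (\<integral>p. f (case p of (r, \<theta>) \<Rightarrow> of_real r * \<theta>) \<partial>(nu_t \<nu>0 t \<Otimes>\<^sub>M unif_circle))"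
    unfolding radial_measure_def by (subst integral_distr) measurable
  also have "\<dots> = (\<integral>r. \<integral>\<theta>. f (of_real r * \<theta>) \<partial>unif_circle \<partial>nu_t \<nu>0 t)"
  proof (subst P.integral_fst'[symmetric])
    show "integrable (nu_t \<nu>0 t \<Otimes>\<^sub>M unif_circle) (\<lambda>p. f (case p of (r, \<theta>) \<Rightarrow> of_real r * \<theta>))"
      using f(2) by (intro P.integrable_const_bound[where B = B]) auto
  qed simp
  also have "(\<lambda>r. \<integral>\<theta>. f (of_real r * \<theta>) \<partial>unif_circle) =
      (\<lambda>r. LINT u:{0<..1}|lborel. f (of_real r * cis (2 * pi * u)))"
  proof
    fix r :: real
    have "(\<integral>\<theta>. f (of_real r * \<theta>) \<partial>unif_circle) =
        (\<integral>\<theta>. f (of_real r * cis \<theta>) \<partial>uniform_measure lborel {0..2 * pi})"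
      unfolding unif_circle_def by (subst integral_distr) auto
    also have "\<dots> = (LINT u:{0<..1}|lborel. f (of_real r * cis (0 + (2 * pi - 0) * u)))"
      by (subst integral_uniform_measure_Icc) auto
    finally show "(\<integral>\<theta>. f (of_real r * \<theta>) \<partial>unif_circle) =
      (LINT u:{0<..1}|lborel. f (of_real r * cis (2 * pi * u)))" by simp
  qed
  also have "(\<integral>r. (LINT u:{0<..1}|lborel. f (of_real r * cis (2 * pi * u))) \<partial>nu_t \<nu>0 t) =
     (\<integral>v. (LINT u:{0<..1}|lborel. f (of_real ((1 - t / v) * quantile \<nu>0 v) * cis (2 * pi * u)))
       \<partial>uniform_measure lborel {t..1})"
    unfolding nu_t_def set_lebesgue_integral_def by (subst integral_distr) auto
  also have "\<dots> = (LINT w:{0<..1}|lborel. LINT u:{0<..1}|lborel.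
    f (of_real ((1 - t / (t + (1 - t) * w)) * quantile \<nu>0 (t + (1 - t) * w)) * cis (2 * pi * u)))"
  proof (subst integral_uniform_measure_Icc)
    show "(\<lambda>v. LINT u:{0<..1}|lborel. f (of_real ((1 - t / v) * quantile \<nu>0 v) * cis (2 * pi * u)))
      \<in> borel_measurable borel"
      unfolding set_lebesgue_integral_def by measurable
  qed (use assms in auto)
  finally show ?thesis .
qed

section \<open>Quantiles and order statistics\<close>

text \<open>No mass sits below 0. This links \<open>quantile\<close>, defined through
  \<open>{0..y}\<close>, to the distribution function in terms of which weak convergence is
  stated.\<close>

lemma (in real_distribution) measure_Icc_eq_cdf:
  assumes "measure M {0..A} = 1" "y \<ge> 0"
  shows "measure M {0..y} = cdf M y"
proof -
  have "measure M {..<0} + measure M {0..A} = measure M ({..<0} \<union> {0..A})"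
    by (intro finite_measure_Union[symmetric]) auto
  also have "\<dots> \<le> 1" by (rule prob_le_1)
  finally have 0: "measure M {..<0} = 0" using assms measure_nonneg[of M "{..<0}"] by linarith
  have "measure M {..y} = measure M ({..<0} \<union> {0..y})" using assms by (intro arg_cong[where f = "measure M"]) auto
  also have "\<dots> = measure M {..<0} + measure M {0..y}"
    by (intro finite_measure_Union) auto
  finally show ?thesis using 0 by (simp add: cdf_def2)
qed

text \<open>The Galois connection between quantile and distribution function. Its nontrivial
  direction says that the infimum is attained, which is right continuity of the distribution
  function.\<close>

lemma (in real_distribution) quantile_le_iff:
  assumes A: "measure M {0..A} = 1" and "x \<le> 1" "y \<ge> 0"
  shows "quantile M x \<le> y \<longleftrightarrow> x \<le> measure M {0..y}"
proof
  have bdd: "bdd_below {y. 0 \<le> y \<and> x \<le> measure M {0..y}}" by (intro bdd_belowI[of _ 0]) auto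
  {
    assume "x \<le> measure M {0..y}"
    then show "quantile M x \<le> y" unfolding quantile_def using assms by (intro cInf_lower bdd) auto
  }
  assume le: "quantile M x \<le> y"
  have "0 \<le> A" using A by (cases "0 \<le> A") auto
  then have "A \<in> {y. 0 \<le> y \<and> x \<le> measure M {0..y}}" using assms by simp
  then have ne: "{y. 0 \<le> y \<and> x \<le> measure M {0..y}} \<noteq> {}" by blast
  have "x \<le> cdf M z" if "z > y" for z
  proof -
    have "quantile M x < z" using le that by simp
    then obtain s where s: "0 \<le> s" "x \<le> measure M {0..s}" "s < z"
      unfolding quantile_def using cInf_less_iff[OF ne bdd] by auto
    then have "x \<le> cdf M s" using measure_Icc_eq_cdf[OF A] by simp
    also have "\<dots> \<le> cdf M z" using s by (intro cdf_nondecreasing) auto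
    finally show ?thesis .
  qed
  then have "\<forall>\<^sub>F z in at_right y. x \<le> cdf M z"
    by (auto simp: eventually_at_filter)
  moreover have "(cdf M \<longlongrightarrow> cdf M y) (at_right y)"
    using cdf_is_right_cont[of y] by (simp add: continuous_within)
  ultimately have "x \<le> cdf M y" by (intro tendsto_lowerbound[where F = "at_right y"]) auto
  then show "x \<le> measure M {0..y}" using measure_Icc_eq_cdf[OF A] assms by simp
qed

lemma (in real_distribution) quantile_nonneg:
  assumes A: "measure M {0..A} = 1" and "x \<le> 1"
  shows "quantile M x \<ge> 0"
proof -
  have "0 \<le> A" using A by (cases "0 \<le> A") auto
  then have "A \<in> {y. 0 \<le> y \<and> x \<le> measure M {0..y}}" using assms by simp
  then have ne: "{y. 0 \<le> y \<and> x \<le> measure M {0..y}} \<noteq> {}" by blast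
  then show ?thesis unfolding quantile_def by (intro cInf_greatest) auto
qed

lemma (in real_distribution) quantile_mono:
  assumes A: "measure M {0..A} = 1" and "x \<le> y" "y \<le> 1"
  shows "quantile M x \<le> quantile M y"
proof -
  have "y \<le> measure M {0..quantile M y}"
    using quantile_le_iff[OF A \<open>y \<le> 1\<close> quantile_nonneg[OF A \<open>y \<le> 1\<close>]] by simp
  then show ?thesis using assms quantile_nonneg[OF A \<open>y \<le> 1\<close>] by (subst quantile_le_iff[OF A]) auto
qed

text \<open>A monotone function has countably many discontinuities, and an injective affine map
  pulls them back to a countable set.\<close>

lemma (in real_distribution) AE_isCont_quantile_affine:
  assumes A: "measure M {0..A} = 1" and t: "0 \<le> t" "t < 1"
  shows "AE w in lborel. w \<in> {0<..<1} \<longrightarrow> isCont (quantile M) (t + (1 - t) * w)"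
proof -
  have "mono_on {0<..<1} (quantile M)"
    by (intro mono_onI quantile_mono[OF A]) auto
  then have "countable {a\<in>{0<..<1}. \<not> isCont (quantile M) a}"
    by (intro mono_on_ctble_discont_open) auto
  then have "countable ((\<lambda>v. (v - t) / (1 - t)) ` {a\<in>{0<..<1}. \<not> isCont (quantile M) a})"
    by (rule countable_image)
  moreover have "{w\<in>{0<..<1}. \<not> isCont (quantile M) (t + (1 - t) * w)} \<subseteq>
      (\<lambda>v. (v - t) / (1 - t)) ` {a\<in>{0<..<1}. \<not> isCont (quantile M) a}"
  proof
    fix w assume w: "w \<in> {w\<in>{0<..<1}. \<not> isCont (quantile M) (t + (1 - t) * w)}"
    have "(1 - t) * w < (1 - t) * 1" using w t by (intro mult_strict_left_mono) auto
    then have less: "t + (1 - t) * w < 1" by (simp add: algebra_simps)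
    have "(1 - t) * w > 0" using w t by simp
    then have "0 < t + (1 - t) * w" using t by linarith
    with less have "t + (1 - t) * w \<in> {0<..<1}" by simp
    then show "w \<in> (\<lambda>v. (v - t) / (1 - t)) ` {a\<in>{0<..<1}. \<not> isCont (quantile M) a}"
      using w t by (intro image_eqI[of _ _ "t + (1 - t) * w"]) auto
  qed
  ultimately have "{w\<in>{0<..<1}. \<not> isCont (quantile M) (t + (1 - t) * w)} \<in> null_sets lborel"
    by (intro countable_imp_null_set_lborel) (rule countable_subset)
  then show ?thesis by (rule AE_I') auto
qed

text \<open>By sortedness, comparing \<open>r n j\<close> with \<open>y\<close> amounts to comparing
  \<open>j\<close> with the number of points up to \<open>y\<close>. Continuity of the quantile
  function at \<open>v\<close> provides a rank \<open>w\<close> on either side of \<open>v\<close>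
  with almost the same quantile; the gap between \<open>v\<close> and \<open>w\<close> absorbs the
  fluctuation of \<open>p n / n\<close> and of the empirical distribution function.\<close>

lemma (in real_distribution) order_statistic_tendsto_quantile:
  assumes A: "measure M {0..A} = 1"
    and r: "\<And>n j. n \<ge> 1 \<Longrightarrow> j \<in> {1..n} \<Longrightarrow> r n j \<ge> 0" "\<And>n. n \<ge> 1 \<Longrightarrow> mono_on {1..n} (r n)"
    and conv: "weak_conv_m (\<lambda>n. empirical_measure (image_mset (r n) (mset_set {1..n}))) M"
    and p: "(\<lambda>n. real (p n) / real n) \<longlonglongrightarrow> v" and v: "0 < v" "v < 1" "isCont (quantile M) v"
  shows "(\<lambda>n. r n (p n)) \<longlonglongrightarrow> quantile M v"
proof -
  define c where "c = (\<lambda>n y. real (card {j\<in>{1..n}. r n j \<le> y}))"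
  have cdf: "cdf (empirical_measure (image_mset (r n) (mset_set {1..n}))) y = c n y / real n"
    if "n \<ge> 1" for n y
  proof -
    have "(\<Sum>x\<in>#image_mset (r n) (mset_set {1..n}). indicator {..y} x :: real) =
        (\<Sum>j\<in>{1..n}. indicator {..y} (r n j))"
      by (simp add: image_mset.compositionality comp_def sum_unfold_sum_mset)
    also have "\<dots> = (\<Sum>j\<in>{1..n}. if r n j \<le> y then 1 else 0)"
      by (intro sum.cong) (auto simp: indicator_def)
    also have "\<dots> = (\<Sum>j\<in>{j\<in>{1..n}. r n j \<le> y}. 1)"
      by (rule sum.inter_filter[symmetric]) simp
    also have "\<dots> = c n y" unfolding c_def by simp
    finally show ?thesis using that
      unfolding cdf_def2 by (subst empirical_measure_eq) (auto simp: mset_set_empty_iff)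
  qed
  have lim: "(\<lambda>n. c n y / real n) \<longlonglongrightarrow> cdf M y" if "isCont (cdf M) y" for y
  proof (rule Lim_transform_eventually)
    show "(\<lambda>n. cdf (empirical_measure (image_mset (r n) (mset_set {1..n}))) y) \<longlonglongrightarrow> cdf M y"
      using conv that by (simp add: weak_conv_m_def weak_conv_def)
    show "\<forall>\<^sub>F n in sequentially. cdf (empirical_measure (image_mset (r n) (mset_set {1..n}))) y = c n y / real n"
      using eventually_ge_at_top[of 1] by eventually_elim (rule cdf)
  qed
  \<comment> \<open>Weak convergence speaks only about continuity points of \<open>cdf M\<close>;
    the others are countable, so any gap contains a usable threshold.\<close>
  have dense: "\<exists>y. a < y \<and> y < b \<and> isCont (cdf M) y" if "a < b" for a b :: real
    using open_minus_countable[OF countable_support, of "{a<..<b}"] that by (auto simp: isCont_cdf)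
  have n1: "\<forall>\<^sub>F n in sequentially. n \<ge> 1" by (rule eventually_ge_at_top)
  have p1: "\<forall>\<^sub>F n in sequentially. p n \<in> {1..n}"
    using n1 order_tendstoD(1)[OF p v(1)] order_tendstoD(2)[OF p v(2)]
  proof eventually_elim
    case (elim n)
    then have "real (p n) < real n" "p n \<noteq> 0" by (auto simp: divide_simps)
    then show ?case by auto
  qed
  show ?thesis
  proof (rule order_tendstoI)
    fix a assume a: "a < quantile M v"
    show "\<forall>\<^sub>F n in sequentially. a < r n (p n)"
    \<comment> \<open>\<open>quantile_le_iff\<close> needs a nonnegative threshold; below 0 the
      claim is just nonnegativity of the points.\<close>
    proof (cases "a < 0")
      case True
      show ?thesis using p1 n1
      proof eventually_elim
        case (elim n)
        then show ?case using r(1)[of n "p n"] True by simp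
      qed
    next
      case False
      have "\<forall>\<^sub>F w in at_left v. a < quantile M w"
        using v(3) a unfolding isCont_def
        by (intro order_tendstoD) (auto intro: tendsto_within_subset)
      moreover have "\<forall>\<^sub>F w in at_left v. w \<in> {0<..<v}" by (rule eventually_at_leftI[OF _ v(1)])
      ultimately have "\<forall>\<^sub>F w in at_left v. a < quantile M w \<and> w \<in> {0<..<v}"
        by (rule eventually_conj)
      from eventually_happens'[OF _ this] obtain w where w: "a < quantile M w" "0 < w" "w < v" by auto
      obtain y where y: "a < y" "y < quantile M w" "isCont (cdf M) y" using dense[OF w(1)] by auto
      have "cdf M y < w"
        using y w v(2) quantile_le_iff[OF A, of w y] False measure_Icc_eq_cdf[OF A, of y] by auto
      then have "\<forall>\<^sub>F n in sequentially. c n y / real n < w" using order_tendstoD(2)[OF lim[OF y(3)]] by auto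
      then show ?thesis using order_tendstoD(1)[OF p w(3)] p1 n1
      proof eventually_elim
        case (elim n)
        then have less: "c n y < real (p n)" by (auto simp: divide_simps)
        have "\<not> r n (p n) \<le> y"
        proof
          assume *: "r n (p n) \<le> y"
          have "{1..p n} \<subseteq> {j\<in>{1..n}. r n j \<le> y}"
          proof
            fix j assume "j \<in> {1..p n}"
            then show "j \<in> {j\<in>{1..n}. r n j \<le> y}"
              using elim(3) * mono_onD[OF r(2)[OF elim(4)], of j "p n"] by simp
          qed
          then have "card {1..p n} \<le> card {j\<in>{1..n}. r n j \<le> y}" by (intro card_mono) auto
          then show False using less unfolding c_def by simp
        qed
        then show ?case using y by simp
      qed
    qed
  next
    fix b assume b: "quantile M v < b"
    have "\<forall>\<^sub>F w in at_right v. quantile M w < b"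
      using v(3) b unfolding isCont_def
      by (intro order_tendstoD) (auto intro: tendsto_within_subset)
    moreover have "\<forall>\<^sub>F w in at_right v. w \<in> {v<..<1}" by (rule eventually_at_rightI[OF _ v(2)])
    ultimately have "\<forall>\<^sub>F w in at_right v. quantile M w < b \<and> w \<in> {v<..<1}"
      by (rule eventually_conj)
    from eventually_happens'[OF _ this] obtain w where w: "quantile M w < b" "v < w" "w < 1" by auto
    obtain y where y: "quantile M w < y" "y < b" "isCont (cdf M) y" using dense[OF w(1)] by auto
    have "0 \<le> y" using y quantile_nonneg[OF A, of w] w by linarith
    then have "w \<le> cdf M y"
      using y w quantile_le_iff[OF A, of w y] measure_Icc_eq_cdf[OF A, of y] by auto
    \<comment> \<open>Only \<open>w \<le> cdf M y\<close> is known, so a value strictly between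
      \<open>v\<close> and \<open>w\<close> is needed to separate the two sequences.\<close>
    then have "\<forall>\<^sub>F n in sequentially. (v + w) / 2 < c n y / real n"
      using order_tendstoD(1)[OF lim[OF y(3)], of "(v + w) / 2"] w by simp
    moreover have "\<forall>\<^sub>F n in sequentially. real (p n) / real n < (v + w) / 2"
      using order_tendstoD(2)[OF p, of "(v + w) / 2"] w by simp
    ultimately show "\<forall>\<^sub>F n in sequentially. r n (p n) < b" using p1 n1
    proof eventually_elim
      case (elim n)
      then have "real (p n) / real n < c n y / real n" by linarith
      then have less: "real (p n) < c n y" using elim by (auto simp: divide_simps)
      have "r n (p n) \<le> y"
      proof (rule ccontr)
        assume *: "\<not> r n (p n) \<le> y"
        have "{j\<in>{1..n}. r n j \<le> y} \<subseteq> {1..p n}"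
        proof
          fix j assume j: "j \<in> {j\<in>{1..n}. r n j \<le> y}"
          have "\<not> p n \<le> j"
            using elim(3) * j mono_onD[OF r(2)[OF elim(4)], of "p n" j] by auto
          then show "j \<in> {1..p n}" using j by auto
        qed
        then have "card {j\<in>{1..n}. r n j \<le> y} \<le> card {1..p n}" by (intro card_mono) auto
        then show False using less unfolding c_def by simp
      qed
      then show ?case using y by simp
    qed
  qed
qed

text \<open>On \<open>{t..1}\<close> the function \<open>h\<close> is a product of nonnegative
  increasing factors, so its sublevel sets are intervals starting at \<open>t\<close>. The scaling
  by \<open>1 - t\<close> cancels the normalization of the uniform law, so the mass of
  \<open>{0..y}\<close> is the length of such an interval, and for \<open>x > 0\<close> it reaches
  \<open>x\<close> exactly when \<open>h (t + x) \<le> y\<close>.\<close>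

lemma quantile_scale_nu_t:
  assumes "real_distribution \<nu>0" and A: "measure \<nu>0 {0..A} = 1" and t: "0 < t" "t < 1"
    and x: "x \<in> {0..1 - t}"
  shows "quantile (scale_measure (ennreal (1 - t)) (nu_t \<nu>0 t)) x = x / (x + t) * quantile \<nu>0 (x + t)"
proof -
  interpret real_distribution \<nu>0 by fact
  define h where "h = (\<lambda>v. (1 - t / v) * quantile \<nu>0 v)"
  have q[measurable]: "quantile \<nu>0 \<in> borel_measurable borel"
    using assms by (intro measurable_quantile)
  have [measurable]: "h \<in> borel_measurable borel" unfolding h_def by measurable
  have h0: "h v \<ge> 0" if "v \<in> {t..1}" for v
    unfolding h_def using that t quantile_nonneg[OF A, of v] by (intro mult_nonneg_nonneg) auto
  have h_mono: "h v \<le> h w" if "t \<le> v" "v \<le> w" "w \<le> 1" for v w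
    unfolding h_def using that t quantile_mono[OF A, of v w] quantile_nonneg[OF A, of v]
    by (intro mult_mono) (auto simp: frac_le)
  have meas: "measure (scale_measure (ennreal (1 - t)) (nu_t \<nu>0 t)) {0..y} =
      measure lborel {v\<in>{t..1}. h v \<le> y}" for y
  proof -
    have "measure (nu_t \<nu>0 t) {0..y} = measure (uniform_measure lborel {t..1}) {v. h v \<in> {0..y}}"
      unfolding nu_t_def h_def by (subst measure_distr) (auto simp: vimage_def)
    also have "\<dots> = measure lborel ({t..1} \<inter> {v. h v \<in> {0..y}}) / measure lborel {t..1}"
      using t by (intro measure_uniform_measure) auto
    also have "{t..1} \<inter> {v. h v \<in> {0..y}} = {v\<in>{t..1}. h v \<le> y}" using h0 by auto
    finally show ?thesis using t by (simp add: measure_scale_measure)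
  qed
  have fmeasurable: "{v\<in>{t..1}. h v \<le> y} \<in> fmeasurable lborel" for y
  proof (rule fmeasurableI2)
    show "{t..1} \<in> fmeasurable lborel" by (simp add: fmeasurable_def emeasure_lborel_Icc_eq)
  qed auto
  have sub: "measure lborel {v\<in>{t..1}. h v \<le> y} \<le> measure lborel {t..b}"
    if "{v\<in>{t..1}. h v \<le> y} \<subseteq> {t..b}" for y b
    using that by (intro measure_mono_fmeasurable) (auto simp: fmeasurable_def emeasure_lborel_Icc_eq)
  show ?thesis
  \<comment> \<open>At \<open>x = 0\<close> both sides are 0. The case is separate because
    \<open>1 - t / v\<close>, a divisor below, vanishes at \<open>v = t\<close>.\<close>
  proof (cases "x = 0")
    case True
    then have "{y. 0 \<le> y \<and> x \<le> measure (scale_measure (ennreal (1 - t)) (nu_t \<nu>0 t)) {0..y}} = {0..}"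
      by auto
    then show ?thesis unfolding quantile_def by (simp add: True cInf_atLeast)
  next
    case False
    define v where "v = t + x"
    have v: "t < v" "v \<le> 1" using False x by (auto simp: v_def)
    have iff: "x \<le> measure lborel {v\<in>{t..1}. h v \<le> y} \<longleftrightarrow> h v \<le> y" if y: "y \<ge> 0" for y
    proof
      assume "h v \<le> y"
      have "{t..v} \<subseteq> {v\<in>{t..1}. h v \<le> y}"
      proof
        fix w assume "w \<in> {t..v}"
        then show "w \<in> {v\<in>{t..1}. h v \<le> y}" using h_mono[of w v] v \<open>h v \<le> y\<close> by simp
      qed
      then have "measure lborel {t..v} \<le> measure lborel {v\<in>{t..1}. h v \<le> y}"
        by (intro measure_mono_fmeasurable fmeasurable) auto
      then show "x \<le> measure lborel {v\<in>{t..1}. h v \<le> y}" using v by (simp add: v_def)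
    next
      assume le: "x \<le> measure lborel {v\<in>{t..1}. h v \<le> y}"
      show "h v \<le> y"
      proof (rule ccontr)
        assume "\<not> h v \<le> y"
        then have "y < (1 - t / v) * quantile \<nu>0 v" by (simp add: h_def)
        moreover have c: "1 - t / v > 0" using v t by simp
        ultimately have "y / (1 - t / v) < quantile \<nu>0 v" by (simp only: pos_divide_less_eq mult.commute)
        \<comment> \<open>Left continuity of \<open>h\<close> at \<open>v\<close>, one factor at a
          time: \<open>1 - t / w\<close> is continuous, and by the Galois connection
          \<open>y'\<close> stays below \<open>quantile \<nu>0 w\<close> once \<open>w\<close>
          exceeds \<open>measure \<nu>0 {0..y'}\<close>, which is less than \<open>v\<close>. So
          \<open>h\<close> already exceeds \<open>y\<close> at some \<open>w < v\<close>, and the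
          sublevel set is shorter than \<open>x\<close>.\<close>
        then obtain y' where y': "y / (1 - t / v) < y'" "y' < quantile \<nu>0 v" using dense by blast
        have "0 \<le> y / (1 - t / v)" using y c by simp
        then have "y' > 0" using y' by linarith
        have less: "measure \<nu>0 {0..y'} < v" using y' quantile_le_iff[OF A v(2), of y'] \<open>y' > 0\<close> by auto
        have lim: "((\<lambda>w. (1 - t / w) * y') \<longlongrightarrow> (1 - t / v) * y') (at_left v)"
          using v t by (intro tendsto_intros) auto
        have "y < (1 - t / v) * y'" using y'(1) c by (simp only: pos_divide_less_eq mult.commute)
        then have "\<forall>\<^sub>F w in at_left v. y < (1 - t / w) * y'"
          by (rule order_tendstoD(1)[OF lim])
        moreover have "\<forall>\<^sub>F w in at_left v. w \<in> {max t (measure \<nu>0 {0..y'})<..<v}"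
          by (rule eventually_at_leftI[of "max t (measure \<nu>0 {0..y'})" v]) (use v less in auto)
        ultimately have "\<forall>\<^sub>F w in at_left v. y < (1 - t / w) * y' \<and> w \<in> {max t (measure \<nu>0 {0..y'})<..<v}"
          by (rule eventually_conj)
        from eventually_happens'[OF _ this] obtain w
          where w: "y < (1 - t / w) * y'" "t < w" "measure \<nu>0 {0..y'} < w" "w < v"
          by auto
        have "y' < quantile \<nu>0 w" using quantile_le_iff[OF A, of w y'] \<open>y' > 0\<close> w v by auto
        moreover have "1 - t / w > 0" using w t by simp
        ultimately have "(1 - t / w) * y' < h w" unfolding h_def by simp
        then have "y < h w" using w by linarith
        have "{v\<in>{t..1}. h v \<le> y} \<subseteq> {t..w}"
        proof
          fix v' assume v': "v' \<in> {v\<in>{t..1}. h v \<le> y}"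
          then have "\<not> w \<le> v'" using h_mono[of w v'] \<open>y < h w\<close> w(2) by auto
          then show "v' \<in> {t..w}" using v' by simp
        qed
        from sub[OF this] have "x \<le> w - t" using le w by simp
        then show False using w by (simp add: v_def)
      qed
    qed
    have "{y. 0 \<le> y \<and> x \<le> measure (scale_measure (ennreal (1 - t)) (nu_t \<nu>0 t)) {0..y}} = {h v..}"
    proof -
      have "h v \<ge> 0" using h0[of v] v by simp
      then have "0 \<le> y \<and> x \<le> measure lborel {v \<in> {t..1}. h v \<le> y} \<longleftrightarrow> h v \<le> y" for y
        using iff[of y] by linarith
      then show ?thesis unfolding meas by auto
    qed
    moreover have "h v = x / (x + t) * quantile \<nu>0 (x + t)"
      using v t by (simp add: h_def v_def field_simps)
    ultimately show ?thesis unfolding quantile_def by (simp add: cInf_atLeast)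
  qed
qed

section \<open>Convergence of the root measures\<close>

text \<open>Up to rounding, \<open>e n\<close> is the geometric mean of \<open>n / m n\<close> and
  \<open>n\<close>, the two scales between which the window has to lie; both relative errors are
  then of order \<open>1 / sqrt (m n)\<close>, apart from a rounding term
  \<open>1 / n\<close>.\<close>

lemma ceiling_window:
  fixes m e :: "nat \<Rightarrow> nat"
  assumes m: "filterlim m at_top sequentially"
    and e_def: "\<And>n. e n = nat \<lceil>real n / sqrt (real (m n))\<rceil>"
  shows "(\<lambda>n. real (e n) / real n) \<longlonglongrightarrow> 0"
    and "(\<lambda>n. 4 powr (real n / real (m n * e n))) \<longlonglongrightarrow> 1"
    and "\<forall>\<^sub>F n in sequentially. e n \<ge> 1"
proof -
  have sq: "filterlim (\<lambda>n. sqrt (real (m n))) at_top sequentially"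
    by (intro filterlim_compose[OF sqrt_at_top] filterlim_compose[OF filterlim_real_sequentially] m)
  have s0: "(\<lambda>n. 1 / sqrt (real (m n))) \<longlonglongrightarrow> 0"
    using tendsto_inverse_0_at_top[OF sq] by (simp add: inverse_eq_divide)
  have pos: "\<forall>\<^sub>F n in sequentially. m n > 0 \<and> n > 0"
    by (intro eventually_conj eventually_compose_filterlim[OF eventually_gt_at_top[of 0] m] eventually_gt_at_top)
  show e1: "\<forall>\<^sub>F n in sequentially. e n \<ge> 1"
    using pos
  proof eventually_elim
    case (elim n)
    then have "real n / sqrt (real (m n)) > 0" by simp
    then show ?case unfolding e_def by linarith
  qed
  show "(\<lambda>n. real (e n) / real n) \<longlonglongrightarrow> 0"
  proof (rule tendsto_sandwich[where f = "\<lambda>_. 0" and h = "\<lambda>n. 1 / sqrt (real (m n)) + 1 / real n"])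
    show "(\<lambda>n. 1 / sqrt (real (m n)) + 1 / real n) \<longlonglongrightarrow> 0"
      using tendsto_add[OF s0 lim_inverse_n] by (simp add: inverse_eq_divide)
    show "\<forall>\<^sub>F n in sequentially. real (e n) / real n \<le> 1 / sqrt (real (m n)) + 1 / real n"
      using pos
    proof eventually_elim
      case (elim n)
      have "real n / sqrt (real (m n)) \<ge> 0" by simp
      then have "real (e n) \<le> real n / sqrt (real (m n)) + 1" unfolding e_def by linarith
      then have "real (e n) / real n \<le> (real n / sqrt (real (m n)) + 1) / real n"
        by (rule divide_right_mono) simp
      also have "\<dots> = 1 / sqrt (real (m n)) + 1 / real n" using elim by (simp add: add_divide_distrib)
      finally show ?case .
    qed
  qed auto
  have "(\<lambda>n. real n / real (m n * e n)) \<longlonglongrightarrow> 0"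
  proof (rule tendsto_sandwich[where f = "\<lambda>_. 0" and h = "\<lambda>n. 1 / sqrt (real (m n))"])
    show "\<forall>\<^sub>F n in sequentially. real n / real (m n * e n) \<le> 1 / sqrt (real (m n))"
      using pos e1
    proof eventually_elim
      case (elim n)
      have "real n / sqrt (real (m n)) \<le> real (e n)" unfolding e_def by (rule real_nat_ceiling_ge)
      then have "real n \<le> real (e n) * sqrt (real (m n))" using elim by (simp add: pos_divide_le_eq)
      then have "real n * sqrt (real (m n)) \<le> real (e n) * sqrt (real (m n)) * sqrt (real (m n))"
        by (rule mult_right_mono) simp
      then have "real n * sqrt (real (m n)) \<le> real (m n * e n)" by (simp add: mult_ac)
      then show ?case using elim by (simp add: field_simps)
    qed
  qed (use s0 in auto)
  then have "(\<lambda>n. 4 powr (real n / real (m n * e n))) \<longlonglongrightarrow> 4 powr 0"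
    by (intro tendsto_intros) auto
  then show "(\<lambda>n. 4 powr (real n / real (m n * e n))) \<longlonglongrightarrow> 1" by simp
qed

text \<open>
  The root \<open>x n (i n)\<close> is squeezed between order statistics of \<open>r n\<close> whose indices differ
  from \<open>i n + n - N n\<close> by at most a window \<open>e n\<close> with \<open>e n / n \<longlonglongrightarrow> 0\<close>, which is nevertheless so
  long that the error factor \<open>4 powr (n / (m n * e n))\<close> tends to \<open>1\<close>.
\<close>

lemma (in real_distribution) derivative_root_tendsto:
  fixes x r :: "nat \<Rightarrow> nat \<Rightarrow> real" and l N m i :: "nat \<Rightarrow> nat"
  assumes A: "measure M {0..A} = 1"
    and r: "\<And>n j. n \<ge> 1 \<Longrightarrow> j \<in> {1..n} \<Longrightarrow> r n j \<ge> 0" "\<And>n. n \<ge> 1 \<Longrightarrow> mono_on {1..n} (r n)"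
    and conv: "weak_conv_m (\<lambda>n. empirical_measure (image_mset (r n) (mset_set {1..n}))) M"
    and m: "filterlim m at_top sequentially"
    and upper: "\<And>n k e. n \<ge> 1 \<Longrightarrow> N n < n \<Longrightarrow> k + e \<le> N n \<Longrightarrow> e \<ge> 1 \<Longrightarrow>
      x n (k + 1) \<le> 4 powr (real n / real (m n * e)) *
        (r n (k + (n - N n) + e) * (1 - real (l n) / real (m n * (k + (n - N n) + e))))"
    and lower: "\<And>n k e. n \<ge> 1 \<Longrightarrow> N n < n \<Longrightarrow> k + e \<le> N n \<Longrightarrow> e \<ge> 1 \<Longrightarrow>
      r n (k + (n - N n) + 1) * (1 - real (l n) / real (m n * (k + (n - N n)))) \<le>
        4 powr (real n / real (m n * e)) * x n (k + e)"
    and l: "(\<lambda>n. real (l n) / real (m n * n)) \<longlonglongrightarrow> t"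
    and N: "(\<lambda>n. real (N n) / real n) \<longlonglongrightarrow> 1 - t"
    and i: "(\<lambda>n. real (i n) / real n) \<longlonglongrightarrow> u"
    and u: "0 < u" "u < 1 - t" "0 < t" and cont: "isCont (quantile M) (u + t)"
  shows "(\<lambda>n. x n (i n)) \<longlonglongrightarrow> (1 - t / (u + t)) * quantile M (u + t)"
proof -
  define v where "v = u + t"
  have v: "0 < v" "v < 1" "isCont (quantile M) v" using u cont by (auto simp: v_def)
  define e where "e = (\<lambda>n. nat \<lceil>real n / sqrt (real (m n))\<rceil>)"
  have "e n = nat \<lceil>real n / sqrt (real (m n))\<rceil>" for n by (simp add: e_def)
  note e = ceiling_window[OF m this]
  have inv: "(\<lambda>n. 1 / real n) \<longlonglongrightarrow> 0" using lim_inverse_n by (simp add: inverse_eq_divide)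
  have "\<forall>\<^sub>F n in sequentially. real (i n) / real n > 0" using order_tendstoD(1)[OF i] u by auto
  then have i0: "\<forall>\<^sub>F n in sequentially. i n \<ge> 1"
    by eventually_elim (auto simp: Suc_le_eq zero_less_divide_iff)
  have n1: "\<forall>\<^sub>F n in sequentially. n \<ge> 1" by (rule eventually_ge_at_top)
  have "\<forall>\<^sub>F n in sequentially. real (N n) / real n < 1" using order_tendstoD(2)[OF N] u by auto
  then have Nn: "\<forall>\<^sub>F n in sequentially. N n < n"
    using n1 by eventually_elim (auto simp: divide_less_eq)
  \<comment> \<open>As \<open>0 < u < 1 - t\<close> and \<open>e n\<close> is of smaller order than
    \<open>n\<close>, windows on either side of \<open>i n\<close> eventually fit into
    \<open>{1..N n}\<close>.\<close>
  have "(\<lambda>n. real (i n) / real n + real (e n) / real n - real (N n) / real n) \<longlonglongrightarrow> u + 0 - (1 - t)"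
    by (intro tendsto_intros i N e)
  then have "\<forall>\<^sub>F n in sequentially. real (i n) / real n + real (e n) / real n - real (N n) / real n < 0"
    using u by (intro order_tendstoD(2)) auto
  then have ieN: "\<forall>\<^sub>F n in sequentially. i n + e n < N n"
    using n1 by eventually_elim (auto simp: divide_simps simp flip: of_nat_add)
  have "(\<lambda>n. real (e n) / real n - real (i n) / real n) \<longlonglongrightarrow> 0 - u"
    by (intro tendsto_intros i e)
  then have "\<forall>\<^sub>F n in sequentially. real (e n) / real n - real (i n) / real n < 0"
    using u by (intro order_tendstoD(2)) auto
  then have ei: "\<forall>\<^sub>F n in sequentially. e n < i n"
    using n1 by eventually_elim (auto simp: divide_simps)
  \<comment> \<open>The upper bound is applied with \<open>k = i n - 1\<close> and the lower one
    with \<open>k = i n - e n\<close>, so that \<open>x n (i n)\<close> is the root estimated in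
    both.\<close>
  define P where "P = (\<lambda>n. i n - 1 + (n - N n) + e n)"
  define K where "K = (\<lambda>n. i n - e n + (n - N n))"
  have P: "(\<lambda>n. real (P n) / real n) \<longlonglongrightarrow> v"
  proof (rule Lim_transform_eventually)
    have "(\<lambda>n. real (i n) / real n - 1 / real n + (1 - real (N n) / real n) + real (e n) / real n) \<longlonglongrightarrow>
        u - 0 + (1 - (1 - t)) + 0"
      by (intro tendsto_intros i e N inv)
    then show "(\<lambda>n. real (i n) / real n - 1 / real n + (1 - real (N n) / real n) + real (e n) / real n) \<longlonglongrightarrow> v"
      by (simp add: v_def)
    show "\<forall>\<^sub>F n in sequentially. real (i n) / real n - 1 / real n + (1 - real (N n) / real n) +
        real (e n) / real n = real (P n) / real n"
      using n1 Nn i0 by eventually_elim (simp add: P_def of_nat_diff divide_simps)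
  qed
  have K: "(\<lambda>n. real (K n) / real n) \<longlonglongrightarrow> v"
  proof (rule Lim_transform_eventually)
    have "(\<lambda>n. real (i n) / real n - real (e n) / real n + (1 - real (N n) / real n)) \<longlonglongrightarrow>
        u - 0 + (1 - (1 - t))"
      by (intro tendsto_intros i e N)
    then show "(\<lambda>n. real (i n) / real n - real (e n) / real n + (1 - real (N n) / real n)) \<longlonglongrightarrow> v"
      by (simp add: v_def)
    show "\<forall>\<^sub>F n in sequentially. real (i n) / real n - real (e n) / real n + (1 - real (N n) / real n)
        = real (K n) / real n"
      using n1 Nn ei by eventually_elim (simp add: K_def of_nat_diff divide_simps)
  qed
  have K1: "(\<lambda>n. real (K n + 1) / real n) \<longlonglongrightarrow> v"
    using tendsto_add[OF inv K] by (simp add: add_divide_distrib)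
  have frac: "(\<lambda>n. 1 - real (l n) / real (m n * p n)) \<longlonglongrightarrow> 1 - t / v"
    if p: "(\<lambda>n. real (p n) / real n) \<longlonglongrightarrow> v" for p
  proof (rule Lim_transform_eventually)
    show "(\<lambda>n. 1 - real (l n) / real (m n * n) / (real (p n) / real n)) \<longlonglongrightarrow> 1 - t / v"
      using v by (intro tendsto_intros l p) auto
    show "\<forall>\<^sub>F n in sequentially. 1 - real (l n) / real (m n * n) / (real (p n) / real n) =
        1 - real (l n) / real (m n * p n)"
      using n1 by eventually_elim simp
  qed
  note rlim = order_statistic_tendsto_quantile[OF A r conv _ v]
  have rP: "(\<lambda>n. r n (P n)) \<longlonglongrightarrow> quantile M v" by (rule rlim) (use P in auto)
  have rK: "(\<lambda>n. r n (K n + 1)) \<longlonglongrightarrow> quantile M v" by (rule rlim) (use K1 in auto)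
  show ?thesis unfolding v_def[symmetric]
  proof (rule tendsto_sandwich)
    show "\<forall>\<^sub>F n in sequentially. r n (K n + 1) * (1 - real (l n) / real (m n * K n)) /
        4 powr (real n / real (m n * e n)) \<le> x n (i n)"
      using n1 Nn ieN ei e(3)
    proof eventually_elim
      case (elim n)
      have "r n (K n + 1) * (1 - real (l n) / real (m n * K n)) \<le>
          4 powr (real n / real (m n * e n)) * x n (i n)"
        using lower[of n "i n - e n" "e n"] elim by (simp add: K_def)
      then show ?case by (simp add: pos_divide_le_eq mult.commute)
    qed
    show "\<forall>\<^sub>F n in sequentially. x n (i n) \<le> 4 powr (real n / real (m n * e n)) *
        (r n (P n) * (1 - real (l n) / real (m n * P n)))"
      using n1 Nn ieN i0 e(3)
    proof eventually_elim
      case (elim n)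
      then show ?case using upper[of n "i n - 1" "e n"] by (simp add: P_def)
    qed
    have "(\<lambda>n. 4 powr (real n / real (m n * e n)) * (r n (P n) * (1 - real (l n) / real (m n * P n))))
        \<longlonglongrightarrow> 1 * (quantile M v * (1 - t / v))"
      by (intro tendsto_mult e rP frac P)
    then show "(\<lambda>n. 4 powr (real n / real (m n * e n)) * (r n (P n) * (1 - real (l n) / real (m n * P n))))
        \<longlonglongrightarrow> (1 - t / v) * quantile M v"
      by (simp add: mult.commute)
    have "(\<lambda>n. r n (K n + 1) * (1 - real (l n) / real (m n * K n)) / 4 powr (real n / real (m n * e n)))
        \<longlonglongrightarrow> quantile M v * (1 - t / v) / 1"
      by (intro tendsto_mult tendsto_divide e rK frac K) auto
    then show "(\<lambda>n. r n (K n + 1) * (1 - real (l n) / real (m n * K n)) / 4 powr (real n / real (m n * e n)))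
        \<longlonglongrightarrow> (1 - t / v) * quantile M v"
      by (simp add: mult.commute)
  qed
qed

theorem theorem4p1:
  fixes \<nu>0 :: "real measure"
    and A t :: real
    and r :: "nat \<Rightarrow> nat \<Rightarrow> real"
    and m :: "nat \<Rightarrow> nat"
  assumes "real_distribution \<nu>0"
    and "A > 0" and "measure \<nu>0 {0..A} = 1"
    and "\<And>n j. n \<ge> 1 \<Longrightarrow> j \<in> {1..n} \<Longrightarrow> r n j \<ge> 0"
    and "\<And>n. n \<ge> 1 \<Longrightarrow> mono_on {1..n} (r n)"
    and "weak_conv_m (\<lambda>n. empirical_measure (image_mset (r n) (mset_set {1..n}))) \<nu>0"
    and "\<And>n. n \<ge> 1 \<Longrightarrow> m n > 0"
    and "filterlim (\<lambda>n. real (m n) / ln (real n)) at_top sequentially"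
    and "0 < t" and "t < 1"
  shows "weakly_converges
      (\<lambda>n. root_measure
        ((pderiv ^^ nat \<lfloor>real n * real (m n) * t\<rfloor>) (poly_nm n (m n) (r n))))
      (radial_measure (nu_t \<nu>0 t))
    \<and> (\<forall>x\<in>{0..1 - t}.
        quantile (scale_measure (ennreal (1 - t)) (nu_t \<nu>0 t)) x =
          x / (x + t) * quantile \<nu>0 (x + t))"
proof (intro conjI ballI)
  note t = \<open>0 < t\<close> \<open>t < 1\<close>
  show "quantile (scale_measure (ennreal (1 - t)) (nu_t \<nu>0 t)) x = x / (x + t) * quantile \<nu>0 (x + t)"
    if "x \<in> {0..1 - t}" for x
    using quantile_scale_nu_t[OF assms(1,3) t that] .
  interpret real_distribution \<nu>0 by fact
  define l where "l n = nat \<lfloor>real n * real (m n) * t\<rfloor>" for n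
  have n1: "\<forall>\<^sub>F n in sequentially. n \<ge> 1" by (rule eventually_ge_at_top)
  have inv: "(\<lambda>n. 1 / real n) \<longlonglongrightarrow> 0" using lim_inverse_n by (simp add: inverse_eq_divide)
  \<comment> \<open>For \<open>n \<ge> 3\<close> one has \<open>ln n \<ge> 1\<close>, since
    \<open>exp 1 \<le> 3\<close>, so \<open>m n\<close> dominates the ratio.\<close>
  have m: "filterlim m at_top sequentially"
    unfolding filterlim_at_top
  proof
    fix Z :: nat
    have "\<forall>\<^sub>F n in sequentially. real Z \<le> real (m n) / ln (real n)"
      using assms(8) unfolding filterlim_at_top by blast
    then show "\<forall>\<^sub>F n in sequentially. Z \<le> m n"
      using eventually_ge_at_top[of 3]
    proof eventually_elim
      case (elim n)
      have "exp 1 \<le> real n" using exp_le elim(2) by linarith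
      then have ln: "ln (real n) \<ge> 1" using elim(2) by (subst ln_ge_iff) auto
      have "real Z * 1 \<le> real Z * ln (real n)" using ln by (intro mult_left_mono) auto
      also have "\<dots> \<le> real (m n)" using elim(1) ln by (simp add: pos_le_divide_eq)
      finally show ?case by simp
    qed
  qed
  have l_le: "real (l n) \<le> real n * real (m n) * t" "real n * real (m n) * t \<le> real (l n) + 1" for n
  proof -
    have "0 \<le> real n * real (m n) * t" using t by simp
    then show "real (l n) \<le> real n * real (m n) * t" "real n * real (m n) * t \<le> real (l n) + 1"
      unfolding l_def by linarith+
  qed
  have l_less: "l n < n * m n" if "n \<ge> 1" for n
  proof -
    have "real n * real (m n) * t < real n * real (m n) * 1"
      using that assms(7)[OF that] t by (intro mult_strict_left_mono) auto
    then have "real (l n) < real (n * m n)" using l_le(1)[of n] by simp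
    then show ?thesis by (simp only: of_nat_less_iff)
  qed
  \<comment> \<open>The guard \<open>n \<ge> 1\<close> sits inside the existential so that choice
    gives sequences defined for all \<open>n\<close>.\<close>
  have "\<forall>n. \<exists>C s N x. n \<ge> 1 \<longrightarrow> (C \<noteq> 0 \<and> s < m n \<and> s + m n * N + l n = m n * n \<and>
      (\<forall>j\<in>{1..N}. x j \<ge> 0) \<and> mono_on {1..N} x \<and>
      (pderiv ^^ l n) (poly_nm n (m n) (r n)) = smult C (monom 1 s * poly_nm N (m n) x))"
  proof
    fix n
    show "\<exists>C s N x. n \<ge> 1 \<longrightarrow> (C \<noteq> 0 \<and> s < m n \<and> s + m n * N + l n = m n * n \<and>
      (\<forall>j\<in>{1..N}. x j \<ge> 0) \<and> mono_on {1..N} x \<and>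
      (pderiv ^^ l n) (poly_nm n (m n) (r n)) = smult C (monom 1 s * poly_nm N (m n) x))"
    proof (cases "n \<ge> 1")
      case True
      obtain C s N x where "C \<noteq> 0" "s < m n" "s + m n * N + l n = m n * n"
        "\<And>j. j \<in> {1..N} \<Longrightarrow> x j \<ge> 0" "mono_on {1..N} x"
        "(pderiv ^^ l n) (poly_nm n (m n) (r n)) = smult C (monom 1 s * poly_nm N (m n) x)"
        using higher_pderiv_poly_nm[where r = "r n", OF assms(7)[OF True] assms(4)[OF True] less_imp_le[OF l_less[OF True]]]
        by blast
      then show ?thesis by blast
    qed simp
  qed
  then obtain C s N x where fac: "\<And>n. n \<ge> 1 \<Longrightarrow> C n \<noteq> 0" "\<And>n. n \<ge> 1 \<Longrightarrow> s n < m n"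
    "\<And>n. n \<ge> 1 \<Longrightarrow> s n + m n * N n + l n = m n * n"
    "\<And>n j. n \<ge> 1 \<Longrightarrow> j \<in> {1..N n} \<Longrightarrow> x n j \<ge> 0" "\<And>n. n \<ge> 1 \<Longrightarrow> mono_on {1..N n} (x n)"
    "\<And>n. n \<ge> 1 \<Longrightarrow> (pderiv ^^ l n) (poly_nm n (m n) (r n)) =
      smult (C n) (monom 1 (s n) * poly_nm (N n) (m n) (x n))"
    unfolding choice_iff by blast
  have l_lim: "(\<lambda>n. real (l n) / real (m n * n)) \<longlonglongrightarrow> t"
  proof (rule tendsto_sandwich[where f = "\<lambda>n. t - 1 / real n" and h = "\<lambda>_. t"])
    show "(\<lambda>n. t - 1 / real n) \<longlonglongrightarrow> t" using tendsto_diff[OF tendsto_const inv] by simp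
    show "\<forall>\<^sub>F n in sequentially. real (l n) / real (m n * n) \<le> t"
      using n1
    proof eventually_elim
      case (elim n)
      then show ?case using l_le(1)[of n] assms(7)[OF elim] by (simp add: divide_le_eq mult_ac)
    qed
    show "\<forall>\<^sub>F n in sequentially. t - 1 / real n \<le> real (l n) / real (m n * n)"
      using n1
    proof eventually_elim
      case (elim n)
      have m0: "m n \<ge> 1" using assms(7)[OF elim] by simp
      have "t - 1 / real n \<le> t - 1 / real (m n * n)"
        using elim m0 by (intro diff_left_mono divide_left_mono) auto
      also have "\<dots> = (real n * real (m n) * t - 1) / real (m n * n)"
        using elim m0 by (simp add: field_simps)
      also have "\<dots> \<le> real (l n) / real (m n * n)"
        using l_le(2)[of n] by (intro divide_right_mono) auto
      finally show ?case .
    qed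
  qed auto
  have s_lim: "(\<lambda>n. real (s n) / real (m n * n)) \<longlonglongrightarrow> 0"
  proof (rule tendsto_sandwich[where f = "\<lambda>_. 0" and h = "\<lambda>n. 1 / real n"])
    show "\<forall>\<^sub>F n in sequentially. real (s n) / real (m n * n) \<le> 1 / real n"
      using n1
    proof eventually_elim
      case (elim n)
      have "real (s n) / real (m n * n) \<le> real (m n) / real (m n * n)"
        using fac(2)[OF elim] by (intro divide_right_mono) auto
      then show ?case using assms(7)[OF elim] by simp
    qed
  qed (use inv in auto)
  have N_lim: "(\<lambda>n. real (N n) / real n) \<longlonglongrightarrow> 1 - t"
  proof (rule Lim_transform_eventually)
    have "(\<lambda>n. 1 - real (l n) / real (m n * n) - real (s n) / real (m n * n)) \<longlonglongrightarrow> 1 - t - 0"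
      by (intro tendsto_intros l_lim s_lim)
    then show "(\<lambda>n. 1 - real (l n) / real (m n * n) - real (s n) / real (m n * n)) \<longlonglongrightarrow> 1 - t" by simp
    show "\<forall>\<^sub>F n in sequentially. 1 - real (l n) / real (m n * n) - real (s n) / real (m n * n) =
        real (N n) / real n"
      using n1
    proof eventually_elim
      case (elim n)
      have "real (m n) * real (N n) = real (m n * n) - real (l n) - real (s n)"
        using arg_cong[OF fac(3)[OF elim], of real] by simp
      moreover have "real (N n) / real n = (real (m n) * real (N n)) / real (m n * n)"
        using assms(7)[OF elim] by simp
      ultimately show ?case using elim assms(7)[OF elim]
        by (simp add: diff_divide_distrib del: of_nat_mult)
    qed
  qed
  have N_top: "filterlim N at_top sequentially"
  proof -
    have "filterlim (\<lambda>n. real (N n) / real n * real n) at_top sequentially"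
      using t by (intro filterlim_tendsto_pos_mult_at_top[OF N_lim] filterlim_real_sequentially) auto
    moreover have "\<forall>\<^sub>F n in sequentially. real (N n) / real n * real n = real (N n)"
      using n1 by eventually_elim simp
    ultimately have "filterlim (\<lambda>n. real (N n)) at_top sequentially"
      using filterlim_cong[OF refl refl] by fast
    then show ?thesis by (simp add: filterlim_sequentially_iff_filterlim_real)
  qed
  have N_pos: "\<forall>\<^sub>F n in sequentially. N n > 0"
    using eventually_compose_filterlim[OF eventually_gt_at_top[of 0] N_top] .
  show "weakly_converges
      (\<lambda>n. root_measure ((pderiv ^^ nat \<lfloor>real n * real (m n) * t\<rfloor>) (poly_nm n (m n) (r n))))
      (radial_measure (nu_t \<nu>0 t))"
    unfolding weakly_converges_def l_def[symmetric]
  proof (intro allI impI)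
    fix f :: "complex \<Rightarrow> real"
    assume "continuous_on UNIV f \<and> bounded (range f)"
    then obtain B where f: "continuous_on UNIV f" "\<And>z. \<bar>f z\<bar> \<le> B"
      by (auto simp: bounded_iff)
    have [measurable]: "f \<in> borel_measurable borel" using f(1) by (rule borel_measurable_continuous_onI)
    have [measurable]: "cis \<in> borel_measurable borel"
      by (intro borel_measurable_continuous_onI continuous_intros)
    have [measurable]: "quantile \<nu>0 \<in> borel_measurable borel"
      using assms by (intro measurable_quantile)
    \<comment> \<open>\<open>h n j\<close> is the mean of \<open>f\<close> over the
      \<open>j\<close>-th circle of roots, \<open>\<gamma> w\<close> the limiting radius at relative
      rank \<open>w\<close>, and \<open>g w\<close> the corresponding circle mean. The rank
      \<open>w\<close> parametrizes \<open>V = t + (1 - t) w\<close>.\<close>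
    define h where "h = (\<lambda>n j. (\<Sum>k<m n. f (of_real (x n j) * cis (2 * pi * (real k / real (m n))))) / real (m n))"
    define \<gamma> where "\<gamma> = (\<lambda>w. (1 - t / (t + (1 - t) * w)) * quantile \<nu>0 (t + (1 - t) * w))"
    define g where "g = (\<lambda>w. LINT u:{0<..1}|lborel. f (of_real (\<gamma> w) * cis (2 * pi * u)))"
    have h_bound: "\<bar>h n j\<bar> \<le> B" for n j
    proof -
      have "\<bar>\<Sum>k<m n. f (of_real (x n j) * cis (2 * pi * (real k / real (m n))))\<bar> \<le> (\<Sum>k<m n. B)"
        by (intro order_trans[OF sum_abs] sum_mono f(2))
      moreover have "B \<ge> 0" using f(2)[of 0] by linarith
      ultimately show ?thesis unfolding h_def
        by (cases "m n = 0") (auto simp: divide_le_eq mult.commute)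
    qed
    have avg: "(\<lambda>n. (\<Sum>j=1..N n. h n j) / real (N n)) \<longlonglongrightarrow> (LINT w:{0<..1}|lborel. g w)"
    proof (rule average_tendsto_integral[where B = B])
      show "g \<in> borel_measurable borel" unfolding g_def \<gamma>_def set_lebesgue_integral_def by measurable
      have "AE w in lborel. w \<in> {0<..<1} \<longrightarrow> isCont (quantile \<nu>0) (t + (1 - t) * w)"
        by (rule AE_isCont_quantile_affine[OF assms(3)]) (use t in auto)
      then show "AE w in lborel. w \<in> {0<..<1} \<longrightarrow> (\<lambda>n. h n (nat \<lceil>w * real (N n)\<rceil>)) \<longlonglongrightarrow> g w"
      proof (eventually_elim, intro impI)
        fix w :: real
        assume w: "w \<in> {0<..<1}" and "w \<in> {0<..<1} \<longrightarrow> isCont (quantile \<nu>0) (t + (1 - t) * w)"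
        then have cont: "isCont (quantile \<nu>0) ((1 - t) * w + t)" by (simp add: add.commute)
        have w': "0 < (1 - t) * w" "(1 - t) * w < 1 - t"
          using w t by (auto simp: mult_less_cancel_left2)
        have "(\<lambda>n. x n (nat \<lceil>w * real (N n)\<rceil>)) \<longlonglongrightarrow> (1 - t / ((1 - t) * w + t)) * quantile \<nu>0 ((1 - t) * w + t)"
        proof (rule derivative_root_tendsto[OF assms(3,4,5,6) m, where l = l and N = N])
          \<comment> \<open>Rank \<open>w\<close> among the \<open>N n\<close> radii is rank
            \<open>(1 - t) w\<close> relative to \<open>n\<close>, because \<open>N n / n\<close>
            tends to \<open>1 - t\<close>.\<close>
          show "(\<lambda>n. real (nat \<lceil>w * real (N n)\<rceil>) / real n) \<longlonglongrightarrow> (1 - t) * w"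
          proof (rule Lim_transform_eventually)
            have "max 0 w = w" using w by simp
            then show "(\<lambda>n. real (N n) / real n * (real (nat \<lceil>w * real (N n)\<rceil>) / real (N n))) \<longlonglongrightarrow> (1 - t) * w"
              using tendsto_mult[OF N_lim tendsto_ceiling_mult_over[OF N_top, of w]] by (simp only:)
            show "\<forall>\<^sub>F n in sequentially. real (N n) / real n * (real (nat \<lceil>w * real (N n)\<rceil>) / real (N n)) =
                real (nat \<lceil>w * real (N n)\<rceil>) / real n"
              using N_pos by eventually_elim simp
          qed
          fix n k e :: nat
          assume n: "n \<ge> 1" and ke: "N n < n" "k + e \<le> N n" "e \<ge> 1"
          note bounds = higher_pderiv_root_bounds[OF assms(7)[OF n] fac(2,3,1,6)[OF n] assms(4,5)[OF n]
              fac(4,5)[OF n] ke(2,3,1)]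
          show "x n (k + 1) \<le> 4 powr (real n / real (m n * e)) *
            (r n (k + (n - N n) + e) * (1 - real (l n) / real (m n * (k + (n - N n) + e))))"
            by (rule bounds)
          show "r n (k + (n - N n) + 1) * (1 - real (l n) / real (m n * (k + (n - N n)))) \<le>
            4 powr (real n / real (m n * e)) * x n (k + e)"
            by (rule bounds)
        qed (use assms w' cont l_lim N_lim in auto)
        then have "(\<lambda>n. x n (nat \<lceil>w * real (N n)\<rceil>)) \<longlonglongrightarrow> \<gamma> w" by (simp add: \<gamma>_def add.commute)
        then show "(\<lambda>n. h n (nat \<lceil>w * real (N n)\<rceil>)) \<longlonglongrightarrow> g w"
          unfolding h_def g_def by (rule circle_average_tendsto[OF m f])
      qed
    qed (use N_pos h_bound in auto)
    have q0: "(\<lambda>n. real (s n) / real (s n + m n * N n)) \<longlonglongrightarrow> 0"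
    proof (rule tendsto_sandwich[where f = "\<lambda>_. 0" and h = "\<lambda>n. 1 / real (N n)"])
      show "(\<lambda>n. 1 / real (N n)) \<longlonglongrightarrow> 0"
        using filterlim_compose[OF lim_inverse_n N_top] by (simp add: inverse_eq_divide)
      show "\<forall>\<^sub>F n in sequentially. real (s n) / real (s n + m n * N n) \<le> 1 / real (N n)"
        using n1 N_pos
      proof eventually_elim
        case (elim n)
        have "s n * N n \<le> s n + m n * N n" using fac(2)[OF elim(1)] by (intro trans_le_add2 mult_right_mono) auto
        then have "real (s n) * real (N n) \<le> real (s n + m n * N n)" by (simp only: of_nat_le_iff flip: of_nat_mult)
        then have "real (s n) \<le> real (s n + m n * N n) / real (N n)"
          using elim by (simp add: pos_le_divide_eq)
        then have "real (s n) / real (s n + m n * N n) \<le>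
            real (s n + m n * N n) / real (N n) / real (s n + m n * N n)"
          by (rule divide_right_mono) simp
        also have "\<dots> = 1 / real (N n)" using elim assms(7)[OF elim(1)] by (simp del: of_nat_add of_nat_mult)
        finally show ?case .
      qed
    qed auto
    \<comment> \<open>The integral against the root measure is a convex combination of
      \<open>f 0\<close>, from the \<open>s n\<close> zero factors, and the mean over the circles;
      the weight of the former tends to 0.\<close>
    have "(\<lambda>n. real (s n) / real (s n + m n * N n) * f 0 +
        (1 - real (s n) / real (s n + m n * N n)) * ((\<Sum>j=1..N n. h n j) / real (N n)))
      \<longlonglongrightarrow> 0 * f 0 + (1 - 0) * (LINT w:{0<..1}|lborel. g w)"
      by (intro tendsto_intros q0 avg)
    moreover have "\<forall>\<^sub>F n in sequentially. real (s n) / real (s n + m n * N n) * f 0 +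
        (1 - real (s n) / real (s n + m n * N n)) * ((\<Sum>j=1..N n. h n j) / real (N n)) =
        (\<integral>z. f z \<partial>root_measure ((pderiv ^^ l n) (poly_nm n (m n) (r n))))"
      using n1 N_pos
    proof eventually_elim
      case (elim n)
      have m0: "m n > 0" using assms(7) elim by simp
      define S where "S = (\<Sum>j=1..N n. \<Sum>k<m n. f (of_real (x n j) * cis (2 * pi * (real k / real (m n)))))"
      define d where "d = real (s n + m n * N n)"
      have d: "d > 0" "d - real (s n) = real (m n) * real (N n)"
        using m0 elim by (auto simp: d_def intro: add_nonneg_pos)
      have "(\<Sum>j=1..N n. h n j) = S / real (m n)" by (simp add: h_def S_def sum_divide_distrib)
      moreover have "1 - real (s n) / d = real (m n) * real (N n) / d"
        using d by (simp add: field_simps)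
      ultimately have "(1 - real (s n) / d) * ((\<Sum>j=1..N n. h n j) / real (N n)) = S / d"
        using m0 elim by simp
      moreover have "(\<integral>z. f z \<partial>root_measure ((pderiv ^^ l n) (poly_nm n (m n) (r n)))) =
          (real (s n) * f 0 + S) / d"
        unfolding fac(6)[OF elim(1)] S_def d_def
        using fac(1)[OF elim(1)] m0 elim by (intro integral_root_measure_poly_nm) auto
      ultimately show ?case by (simp add: d_def add_divide_distrib)
    qed
    ultimately have "(\<lambda>n. \<integral>z. f z \<partial>root_measure ((pderiv ^^ l n) (poly_nm n (m n) (r n)))) \<longlonglongrightarrow>
        0 * f 0 + (1 - 0) * (LINT w:{0<..1}|lborel. g w)"
      by (rule Lim_transform_eventually)
    moreover have "(\<integral>z. f z \<partial>radial_measure (nu_t \<nu>0 t)) = (LINT w:{0<..1}|lborel. g w)"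
      unfolding g_def \<gamma>_def by (rule integral_radial_measure_nu_t[OF assms(1,3) t f])
    ultimately show "(\<lambda>n. \<integral>z. f z \<partial>root_measure ((pderiv ^^ l n) (poly_nm n (m n) (r n)))) \<longlonglongrightarrow>
        (\<integral>z. f z \<partial>radial_measure (nu_t \<nu>0 t))"
      by simp
  qed
qed

end
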